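(* Let $d\ge2$ be an integer and let $\psi=(\psi(\tau_1,\dots,\tau_d))_{(\tau_1,\dots,\tau_d)\in\Theta^d}$ be a $d$-admissible, $p$-integrable family. For $S\in\Theta$ set $$V(S)=\operatorname*{ess\,sup}_{(\tau_1,\dots,\tau_d)\in\Theta_S^d}\rho_{S,\tau_1\vee\dots\vee\tau_d}[\psi(\tau_1,\dots,\tau_d)],$$ and assume $V(S)\in L^p$ for each $S\in\Theta$. For $i\in\{1,\dots,d\}$ and $S\in\Theta$ define $$u^{(i)}(S)=\operatorname*{ess\,sup}_{(\tau_1,\dots,\tau_{i-1},\tau_{i+1},\dots,\tau_d)\in\Theta_S^{d-1}}\rho_{S,\tau_1\vee\dots\vee\tau_{i-1}\vee S\vee\tau_{i+1}\vee\dots\vee\tau_d}[\psi(\tau_1,\dots,\tau_{i-1},S,\tau_{i+1},\dots,\tau_d)],$$ $$\phi(S)=u^{(1)}(S)\vee\dots\vee u^{(d)}(S),\qquad u(S)=\operatorname*{ess\,sup}_{\tau\in\Theta_S}\rho_{S,\tau}[\phi(\tau)].$$ Let $S\in\Theta$ and suppose that a given $d$-tuple $(\tau_1^*,\dots,\tau_d^* )\in\Theta_S^d$ is optimal for $V(S)$, i.e. $V(S)=\rho_{S,\tau_1^*\vee\dots\vee\tau_d^*}[\psi(\tau_1^*,\dots,\tau_d^* )]$. Write $m^*=\tau_1^*\wedge\dots\wedge\tau_d^*$, and let $(A_i)_{i\in\{1,\dots,d\}}$ be a partition of $\Omega$ such that, for each $i$, $A_i\in\mathcal F_{m^*}$ and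 $\tau_i^*=m^*$ on $A_i$. Then: i) $m^*$ is optimal for $u(S)$, i.e. $u(S)=\rho_{S,m^*}[\phi(m^* )]$. Moreover, if $\rho$ is strictly monotone, then: ii) for each $i\in\{1,\dots,d\}$, the vector $\theta^{(-i),*}=(\tau_1^*,\dots,\tau_{i-1}^*,\tau_{i+1}^*,\dots,\tau_d^* )$ is optimal for $u^{(i)}(m^* )$ on $A_i$, i.e. $$u^{(i)}(m^* )=\rho_{m^*,\,\tau_1^*\vee\dots\vee\tau_{i-1}^*\vee m^*\vee\tau_{i+1}^*\vee\dots\vee\tau_d^*}[\psi(\tau_1^*,\dots,\tau_{i-1}^*,m^*,\tau_{i+1}^*,\dots,\tau_d^* )]\quad\text{a.s. on }A_i.$$
   Context: Let $T>0$ be fixed and let $(\Omega,\mathcal F,P)$ be a complete probability space with a right-continuous complete filtration $(\mathcal F_t)_{t\in[0,T]}$. Equalities and inequalities between random variables, and equalities between measurable sets, are understood $P$-a.s. Let $(\theta_k)_{k\in\mathbb N}$ be a sequence of stopping times with $\theta_0=0$, $\theta_k\le\theta_{k+1}$ a.s. for all $k$, and $\lim_k\theta_k=T$ a.s. $\Theta$ (Bermudan stopping strategies) is the set of stopping times of the form $\tau=\sum_{k\ge0}\theta_k\mathbf 1_{A_k}+T\mathbf 1_{\bar A}$, where $\{(A_k)_{k\ge 0},\bar A\}$ is a partition of $\Omega$ with $A_k\in\mathcal F_{\theta_k}$ and $\bar A\in\mathcal F_T$. For $S\in\Theta$, $\Theta_S=\{\nu\in\Theta:\nu\ge S\text{ a.s.}\}$.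 Fix $p\in[1,+\infty]$. A family $\xi=(\xi(\tau))_{\tau\in\Theta}$ of real random variables is admissible if $\xi(\tau)$ is $\mathcal F_\tau$-measurable and $\xi(\tau)=\xi(\tau')$ a.s. on $\{\tau=\tau'\}$ for all $\tau,\tau'\in\Theta$; it is $p$-integrable if each $\xi(\tau)\in L^p$. A family $(\psi(\tau_1,\dots,\tau_d))_{(\tau_1,\dots,\tau_d)\in\Theta^d}$ is $d$-admissible if $\psi(\tau_1,\dots,\tau_d)$ is $\mathcal F_{\tau_1\vee\dots\vee\tau_d}$-measurable and $\psi(\tau_1,\dots,\tau_d)=\psi(\tilde\tau_1,\dots,\tilde\tau_d)$ on $\bigcap_i\{\tau_i=\tilde\tau_i\}$; it is $p$-integrable if each $\psi(\tau_1,\dots,\tau_d)\in L^p$. Bi-admissible means $2$-admissible. The operators $\rho_{S,\tau}$, $S,\tau\in\Theta$, satisfy: (i) $\rho_{S,\tau}:L^p(\mathcal F_\tau)\to L^p(\mathcal F_S)$. (ii) (admissibility) $\rho_{S,\tau}[\eta]=\rho_{S',\tau}[\eta]$ a.s. on $\{S=S'\}$. (iii) (knowledge preservation) $\rho_{\tau,S}[\eta]=\eta$ for all $\eta\in L^p(\mathcal F_S)$, $\tau\in\Theta_S$. (iv) (monotonicity) $\rho_{S,\tau}[\eta_1]\le\rho_{S,\tau}[\eta_2]$ if $\eta_1\le\eta_2$ a.s. (v) (consistency) $\rho_{S,\theta}[\rho_{\theta,\tau}[\eta]]=\rho_{S,\tau}[\eta]$ for $S\le\theta\le\tau$ in $\Theta$,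 $\eta\in L^p(\mathcal F_\tau)$. (vi) (generalized zero-one law) $\mathbf 1_A\rho_{S,\tau}[\xi(\tau)]=\mathbf 1_A\rho_{S,\tau'}[\xi(\tau')]$ for every admissible $p$-integrable family $\xi$, $A\in\mathcal F_S$, $\tau,\tau'\in\Theta_S$ with $\tau=\tau'$ on $A$. (vi bis) For every bi-admissible $p$-integrable family $\chi$ and all Bermudan stopping times: $\mathbf 1_{\{\tau_1=\tau_1'\}}\rho_{\tau_1,\tau_1\vee\tau_2}[\chi(\tau_1,\tau_2)]=\mathbf 1_{\{\tau_1=\tau_1'\}}\rho_{\tau_1',\tau_1'\vee\tau_2}[\chi(\tau_1',\tau_2)]$ and $\mathbf 1_{\{\tau_2=\tau_2'\}}\rho_{\tau_2,\tau_1\vee\tau_2}[\chi(\tau_1,\tau_2)]=\mathbf 1_{\{\tau_2=\tau_2'\}}\rho_{\tau_2',\tau_1\vee\tau_2'}[\chi(\tau_1,\tau_2')]$. (vi ter) For every bi-admissible $p$-integrable family $\chi$, all $\tau_1,\tau_2\in\Theta$ and $A\in\mathcal F_{\tau_1\wedge\tau_2}$ such that $\tau_1\wedge\tau_2=\tau_1$ and $\tau_1\vee\tau_2=\tau_2$ a.s. on $A$: $\mathbf 1_A\rho_{\tau_1\wedge\tau_2,\tau_1\vee\tau_2}[\chi(\tau_1\wedge\tau_2,\tau_1\vee\tau_2)]=\mathbf 1_A\rho_{\tau_1\wedge\tau_2,\tau_1\vee\tau_2}[\chi(\tau_1,\tau_2)]=\mathbf 1_A\rho_{\tau_1,\tau_1\vee\tau_2}[\chi(\tau_1,\tau_2)]$,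 and $\mathbf 1_A\rho_{\tau_1\wedge\tau_2,\tau_1\vee\tau_2}[\chi(\tau_1\vee\tau_2,\tau_1\wedge\tau_2)]=\mathbf 1_A\rho_{\tau_1\wedge\tau_2,\tau_1\vee\tau_2}[\chi(\tau_2,\tau_1)]=\mathbf 1_A\rho_{\tau_1,\tau_1\vee\tau_2}[\chi(\tau_2,\tau_1)]$. (vii) (monotone Fatou property) $\rho_{S,\tau}[\eta]\le\liminf_n\rho_{S,\tau}[\eta_n]$ whenever $(\eta_n)\subset L^p(\mathcal F_\tau)$ is non-decreasing, $\sup_n\eta_n\in L^p$ and $\eta_n\uparrow\eta$ a.s. ($d$-property) For every $d$-admissible $p$-integrable family $\chi$, all $(\tau_1,\dots,\tau_d),(\tau_1',\dots,\tau_d')\in\Theta^d$ and $A\in\mathcal F_{\tau_1\wedge\dots\wedge\tau_d}$ with $\tau_i=\tau_i'$ on $A$ for all $i$: $\mathbf 1_A\rho_{\tau_1\wedge\dots\wedge\tau_d,\tau_1\vee\dots\vee\tau_d}[\chi(\tau_1,\dots,\tau_d)]=\mathbf 1_A\rho_{\tau_1'\wedge\dots\wedge\tau_d',\tau_1'\vee\dots\vee\tau_d'}[\chi(\tau_1',\dots,\tau_d')]$. $\rho$ is strictly monotone if, for all $S\le\tau$ in $\Theta$ and $\eta_1,\eta_2\in L^p(\mathcal F_\tau)$, $\eta_1\le\eta_2$ a.s. and $\rho_{S,\tau}[\eta_1]=\rho_{S,\tau}[\eta_2]$ a.s. imply $\eta_1=\eta_2$ a.s. *)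

theory Defs
  imports "HOL-Probability.Probability"
begin

section \<open>Essential suprema of families and Lebesgue spaces\<close>

text \<open>Here the essential supremum is that of a possibly uncountable family of random variables,
  a random variable again; it is unrelated to the scalar \<open>esssup\<close> of the library.\<close>

definition is_ess_sup ::
  "'a measure \<Rightarrow> 'i set \<Rightarrow> ('i \<Rightarrow> 'a \<Rightarrow> ereal) \<Rightarrow> ('a \<Rightarrow> ereal) \<Rightarrow> bool" where
  "is_ess_sup M I X Z \<longleftrightarrow>
     Z \<in> borel_measurable M \<and>
     (\<forall>i\<in>I. AE \<omega> in M. X i \<omega> \<le> Z \<omega>) \<and>
     (\<forall>Y\<in>borel_measurable M. (\<forall>i\<in>I. AE \<omega> in M. X i \<omega> \<le> Y \<omega>) \<longrightarrow> (AE \<omega> in M. Z \<omega> \<le> Y \<omega>))"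

definition ess_sup_family ::
  "'a measure \<Rightarrow> 'i set \<Rightarrow> ('i \<Rightarrow> 'a \<Rightarrow> ereal) \<Rightarrow> 'a \<Rightarrow> ereal" where
  "ess_sup_family M I X = (SOME Z. is_ess_sup M I X Z)"

lemma is_ess_sup_unique:
  assumes "is_ess_sup M I X Z" "is_ess_sup M I X Z'"
  shows "AE \<omega> in M. Z \<omega> = Z' \<omega>"
proof -
  have "AE \<omega> in M. Z \<omega> \<le> Z' \<omega>" "AE \<omega> in M. Z' \<omega> \<le> Z \<omega>"
    using assms unfolding is_ess_sup_def by blast+
  then show ?thesis by eventually_elim simp
qed

lemma (in finite_measure) is_ess_sup_exists:
  fixes X :: "'i \<Rightarrow> 'a \<Rightarrow> ereal"
  assumes X: "\<And>i. i \<in> I \<Longrightarrow> X i \<in> borel_measurable M"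
  shows "\<exists>Z. is_ess_sup M I X Z"
proof -
  define g :: "ereal \<Rightarrow> real"
    where "g x = (if x = \<infinity> then 2 else if x = -\<infinity> then -2 else arctan (real_of_ereal x))" for x
  have arctan_bd: "- 2 < arctan r" "arctan r < 2" for r
    using arctan_bounded[of r] pi_less_4 by linarith+
  have g_strict: "g x < g y" if "x < y" for x y
    using that by (cases x; cases y) (auto simp: g_def arctan_less_iff arctan_bd)
  have g_bd: "\<bar>g x\<bar> \<le> 2" for x
    using arctan_bd[of "real_of_ereal x"] by (auto simp: g_def)
  have g_meas[measurable]: "g \<in> borel_measurable borel"
    unfolding g_def by measurable
  define S where "S J \<omega> = (SUP i\<in>J. X i \<omega>)" for J \<omega>
  define C where "C = {J. countable J \<and> J \<subseteq> I}"
  have S_meas: "S J \<in> borel_measurable M" if "J \<in> C" for J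
    unfolding S_def using that X by (intro borel_measurable_SUP) (auto simp: C_def)
  define G where "G J = (\<integral>\<omega>. g (S J \<omega>) \<partial>M)" for J
  have g_int: "integrable M (\<lambda>\<omega>. g (f \<omega>))" if [measurable]: "f \<in> borel_measurable M" for f
    by (rule integrable_const_bound[where B=2]) (use g_bd in auto)
  have g_mono: "g x \<le> g y" if "x \<le> y" for x y
    using g_strict[of x y] that by (cases "x < y") (auto simp: not_less)
  have S_mono: "S J \<omega> \<le> S K \<omega>" if "J \<subseteq> K" for J K \<omega>
    unfolding S_def using that by (rule SUP_subset_mono) simp
  have G_mono: "G J \<le> G K" if "J \<subseteq> K" "J \<in> C" "K \<in> C" for J K
    unfolding G_def
    by (rule integral_mono) (use that in \<open>auto intro!: g_int S_meas g_mono S_mono\<close>)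
  have G_bdd: "G J \<le> 2 * measure M (space M)" if "J \<in> C" for J
  proof -
    have "G J \<le> (\<integral>\<omega>. 2 \<partial>M)" unfolding G_def
      by (rule integral_mono) (use that g_bd in \<open>auto intro!: g_int S_meas simp: abs_le_iff\<close>)
    then show ?thesis by simp
  qed
  then have bdd: "bdd_above (G ` C)" by (auto intro!: bdd_aboveI)
  have "{} \<in> C" by (auto simp: C_def)
  then have ne: "C \<noteq> {}" by auto
  have "\<exists>J\<in>C. (SUP J\<in>C. G J) - 1 / real (Suc n) < G J" for n
    using less_cSUP_iff[OF ne bdd, of "(SUP J\<in>C. G J) - 1 / real (Suc n)"] by simp
  then obtain JJ where JJ: "JJ n \<in> C" "(SUP J\<in>C. G J) - 1 / real (Suc n) < G (JJ n)" for n
    by metis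
  define J where "J = (\<Union>n. JJ n)"
  have JC: "J \<in> C" using JJ(1) by (auto simp: J_def C_def)
  have GJ: "G K \<le> G J" if "K \<in> C" for K
  proof (rule field_le_epsilon)
    fix e :: real assume "e > 0"
    then obtain n where n: "1 / real (Suc n) < e" using nat_approx_posE by blast
    have "G K \<le> (SUP J\<in>C. G J)" using that bdd by (rule cSUP_upper)
    also have "\<dots> < G (JJ n) + e" using JJ(2)[of n] n by linarith
    also have "G (JJ n) \<le> G J" using JJ(1) JC by (intro G_mono) (auto simp: J_def)
    finally show "G K \<le> G J + e" by simp
  qed
  have up: "AE \<omega> in M. X i \<omega> \<le> S J \<omega>" if "i \<in> I" for i
  proof -
    have KC: "insert i J \<in> C" using JC that by (auto simp: C_def)
    have le: "g (S J \<omega>) \<le> g (S (insert i J) \<omega>)" for \<omega> by (intro g_mono S_mono) auto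
    have int: "integrable M (\<lambda>\<omega>. g (S (insert i J) \<omega>) - g (S J \<omega>))"
      by (intro Bochner_Integration.integrable_diff g_int S_meas KC JC)
    have "(\<integral>\<omega>. g (S (insert i J) \<omega>) - g (S J \<omega>) \<partial>M) = G (insert i J) - G J"
      unfolding G_def by (intro Bochner_Integration.integral_diff g_int S_meas KC JC)
    also have "\<dots> = 0" using GJ[OF KC] G_mono[OF subset_insertI JC KC] by linarith
    finally have "AE \<omega> in M. g (S (insert i J) \<omega>) - g (S J \<omega>) = 0"
      using integral_nonneg_eq_0_iff_AE[OF int] le by simp
    then show ?thesis
    proof eventually_elim
      case (elim \<omega>)
      then have "\<not> S J \<omega> < S (insert i J) \<omega>" using g_strict by fastforce
      moreover have "X i \<omega> \<le> S (insert i J) \<omega>" unfolding S_def by (rule SUP_upper) simp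
      ultimately show ?case by simp
    qed
  qed
  have "AE \<omega> in M. S J \<omega> \<le> Y \<omega>" if "\<forall>i\<in>I. AE \<omega> in M. X i \<omega> \<le> Y \<omega>" for Y
  proof -
    have "AE \<omega> in M. \<forall>i\<in>J. X i \<omega> \<le> Y \<omega>"
      using that JC by (subst AE_ball_countable) (auto simp: C_def)
    then show ?thesis by eventually_elim (auto simp: S_def SUP_le_iff)
  qed
  then have "is_ess_sup M I X (S J)"
    unfolding is_ess_sup_def using S_meas[OF JC] up by blast
  then show ?thesis by (intro exI[of _ "S J"])
qed

lemma (in finite_measure) is_ess_sup_ess_sup_family:
  assumes "\<And>i. i \<in> I \<Longrightarrow> X i \<in> borel_measurable M"
  shows "is_ess_sup M I X (ess_sup_family M I X)"
  unfolding ess_sup_family_def using is_ess_sup_exists[OF assms] by (rule someI_ex)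

definition Lp :: "'a measure \<Rightarrow> 'a measure \<Rightarrow> ennreal \<Rightarrow> ('a \<Rightarrow> real) set" where
  "Lp M G p = {f \<in> borel_measurable G.
     if p = \<infinity> then esssup M (\<lambda>\<omega>. ereal \<bar>f \<omega>\<bar>) < \<infinity>
     else integrable M (\<lambda>\<omega>. \<bar>f \<omega>\<bar> powr enn2real p)}"

section \<open>Bermudan stopping strategies\<close>

text \<open>Filtrations are indexed by all reals, as in the library, but all stopping times take values
  in \<open>{0..T}\<close>. For such a \<open>\<tau>\<close>, the conditions at times outside \<open>{0..T}\<close> in
  \<open>stopping_time\<close> and \<open>pre_sigma\<close> follow from those at times in \<open>{0..T}\<close>.\<close>

abbreviation sigma_at :: "'a measure \<Rightarrow> (real \<Rightarrow> 'a measure) \<Rightarrow> ('a \<Rightarrow> real) \<Rightarrow> 'a measure" where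
  "sigma_at M F \<tau> \<equiv> filtration.pre_sigma (space M) F \<tau>"

text \<open>As equality of random variables means almost sure equality, so does membership in the
  following set; in particular the set is closed under finite minima and maxima, although
  \<open>\<theta>\<close> is only almost surely monotone.\<close>

definition bermudan_times ::
  "'a measure \<Rightarrow> (real \<Rightarrow> 'a measure) \<Rightarrow> real \<Rightarrow> (nat \<Rightarrow> 'a \<Rightarrow> real) \<Rightarrow> ('a \<Rightarrow> real) set" where
  "bermudan_times M F T \<theta> = {\<tau>. stopping_time F \<tau> \<and> \<tau> \<in> space M \<rightarrow> {0..T} \<and>
     (\<exists>A A'. (\<forall>k. A k \<in> sets (sigma_at M F (\<theta> k))) \<and> A' \<in> sets (F T) \<and>
        disjoint_family A \<and> (\<forall>k. A k \<inter> A' = {}) \<and> (\<Union>k. A k) \<union> A' = space M \<and>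
        (AE \<omega> in M. \<tau> \<omega> = (\<Sum>k. \<theta> k \<omega> * indicator (A k) \<omega>) + T * indicator A' \<omega>))}"

definition times_from ::
  "'a measure \<Rightarrow> ('a \<Rightarrow> real) set \<Rightarrow> ('a \<Rightarrow> real) \<Rightarrow> ('a \<Rightarrow> real) set" where
  "times_from M \<Theta> S = {\<nu> \<in> \<Theta>. AE \<omega> in M. S \<omega> \<le> \<nu> \<omega>}"

text \<open>A \<open>d\<close>-tuple of times is an element of \<open>{1..d} \<rightarrow>\<^sub>E \<Theta>\<close>.\<close>

definition tuple_max :: "nat set \<Rightarrow> (nat \<Rightarrow> 'a \<Rightarrow> real) \<Rightarrow> 'a \<Rightarrow> real" where
  "tuple_max I \<tau> \<omega> = Max ((\<lambda>i. \<tau> i \<omega>) ` I)"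

definition tuple_min :: "nat set \<Rightarrow> (nat \<Rightarrow> 'a \<Rightarrow> real) \<Rightarrow> 'a \<Rightarrow> real" where
  "tuple_min I \<tau> \<omega> = Min ((\<lambda>i. \<tau> i \<omega>) ` I)"

section \<open>Admissible families\<close>

definition admissible ::
  "'a measure \<Rightarrow> (real \<Rightarrow> 'a measure) \<Rightarrow> ('a \<Rightarrow> real) set \<Rightarrow> (('a \<Rightarrow> real) \<Rightarrow> 'a \<Rightarrow> real) \<Rightarrow> bool" where
  "admissible M F \<Theta> \<xi> \<longleftrightarrow>
     (\<forall>\<tau>\<in>\<Theta>. \<xi> \<tau> \<in> borel_measurable (sigma_at M F \<tau>)) \<and>
     (\<forall>\<tau>\<in>\<Theta>. \<forall>\<tau>'\<in>\<Theta>. AE \<omega> in M. \<tau> \<omega> = \<tau>' \<omega> \<longrightarrow> \<xi> \<tau> \<omega> = \<xi> \<tau>' \<omega>)"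

definition p_integrable ::
  "'a measure \<Rightarrow> ('a \<Rightarrow> real) set \<Rightarrow> ennreal \<Rightarrow> (('a \<Rightarrow> real) \<Rightarrow> 'a \<Rightarrow> real) \<Rightarrow> bool" where
  "p_integrable M \<Theta> p \<xi> \<longleftrightarrow> (\<forall>\<tau>\<in>\<Theta>. \<xi> \<tau> \<in> Lp M M p)"

definition d_admissible ::
  "'a measure \<Rightarrow> (real \<Rightarrow> 'a measure) \<Rightarrow> ('a \<Rightarrow> real) set \<Rightarrow> nat \<Rightarrow>
     ((nat \<Rightarrow> 'a \<Rightarrow> real) \<Rightarrow> 'a \<Rightarrow> real) \<Rightarrow> bool" where
  "d_admissible M F \<Theta> d \<zeta> \<longleftrightarrow>
     (\<forall>\<tau> \<in> {1..d} \<rightarrow>\<^sub>E \<Theta>. \<zeta> \<tau> \<in> borel_measurable (sigma_at M F (tuple_max {1..d} \<tau>))) \<and>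
     (\<forall>\<tau> \<in> {1..d} \<rightarrow>\<^sub>E \<Theta>. \<forall>\<tau>' \<in> {1..d} \<rightarrow>\<^sub>E \<Theta>.
        AE \<omega> in M. (\<forall>i\<in>{1..d}. \<tau> i \<omega> = \<tau>' i \<omega>) \<longrightarrow> \<zeta> \<tau> \<omega> = \<zeta> \<tau>' \<omega>)"

definition d_p_integrable ::
  "'a measure \<Rightarrow> ('a \<Rightarrow> real) set \<Rightarrow> ennreal \<Rightarrow> nat \<Rightarrow>
     ((nat \<Rightarrow> 'a \<Rightarrow> real) \<Rightarrow> 'a \<Rightarrow> real) \<Rightarrow> bool" where
  "d_p_integrable M \<Theta> p d \<zeta> \<longleftrightarrow> (\<forall>\<tau> \<in> {1..d} \<rightarrow>\<^sub>E \<Theta>. \<zeta> \<tau> \<in> Lp M M p)"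

definition bi_admissible ::
  "'a measure \<Rightarrow> (real \<Rightarrow> 'a measure) \<Rightarrow> ('a \<Rightarrow> real) set \<Rightarrow>
     (('a \<Rightarrow> real) \<Rightarrow> ('a \<Rightarrow> real) \<Rightarrow> 'a \<Rightarrow> real) \<Rightarrow> bool" where
  "bi_admissible M F \<Theta> \<zeta> \<longleftrightarrow> d_admissible M F \<Theta> 2 (\<lambda>\<tau>. \<zeta> (\<tau> 1) (\<tau> 2))"

definition bi_p_integrable ::
  "'a measure \<Rightarrow> ('a \<Rightarrow> real) set \<Rightarrow> ennreal \<Rightarrow>
     (('a \<Rightarrow> real) \<Rightarrow> ('a \<Rightarrow> real) \<Rightarrow> 'a \<Rightarrow> real) \<Rightarrow> bool" where
  "bi_p_integrable M \<Theta> p \<zeta> \<longleftrightarrow> d_p_integrable M \<Theta> p 2 (\<lambda>\<tau>. \<zeta> (\<tau> 1) (\<tau> 2))"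

section \<open>Nonlinear operators\<close>

locale bermudan_setting = prob_space M + complete_measure M + filtration "space M" F
  for M :: "'a measure" and F :: "real \<Rightarrow> 'a measure" +
  fixes T :: real and \<theta> :: "nat \<Rightarrow> 'a \<Rightarrow> real"
  assumes T_pos: "0 < T"
    and subalgebra_F: "\<And>t. subalgebra M (F t)"
    and complete_F: "null_sets M \<subseteq> sets (F 0)"
    and right_continuous_F: "\<And>t. t \<in> {0..<T} \<Longrightarrow> sets (F t) = (\<Inter>s\<in>{t<..T}. sets (F s))"
    and stopping_time_\<theta>: "\<And>k. stopping_time F (\<theta> k)"
    and range_\<theta>: "\<And>k. \<theta> k \<in> space M \<rightarrow> {0..T}"
    and \<theta>_0: "AE \<omega> in M. \<theta> 0 \<omega> = 0"
    and \<theta>_mono: "\<And>k. AE \<omega> in M. \<theta> k \<omega> \<le> \<theta> (Suc k) \<omega>"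
    and \<theta>_lim: "AE \<omega> in M. (\<lambda>k. \<theta> k \<omega>) \<longlonglongrightarrow> T"
begin

abbreviation \<Theta> :: "('a \<Rightarrow> real) set" where
  "\<Theta> \<equiv> bermudan_times M F T \<theta>"

abbreviation \<Theta>_from :: "('a \<Rightarrow> real) \<Rightarrow> ('a \<Rightarrow> real) set" where
  "\<Theta>_from \<equiv> times_from M \<Theta>"

end

text \<open>The operators act on functions rather than on classes of almost surely equal functions;
  that they respect almost sure equality is a consequence of monotonicity.\<close>

locale nonlinear_operators = bermudan_setting M F T \<theta>
  for M :: "'a measure" and F :: "real \<Rightarrow> 'a measure" and T :: real
    and \<theta> :: "nat \<Rightarrow> 'a \<Rightarrow> real" +
  fixes p :: ennreal
    and \<rho> :: "('a \<Rightarrow> real) \<Rightarrow> ('a \<Rightarrow> real) \<Rightarrow> ('a \<Rightarrow> real) \<Rightarrow> 'a \<Rightarrow> real"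
  assumes p_ge_1: "1 \<le> p"
    and maps_Lp: "\<And>S \<tau> \<eta>. S \<in> \<Theta> \<Longrightarrow> \<tau> \<in> \<Theta> \<Longrightarrow> \<eta> \<in> Lp M (pre_sigma \<tau>) p \<Longrightarrow>
      \<rho> S \<tau> \<eta> \<in> Lp M (pre_sigma S) p"
    and admissibility: "\<And>S S' \<tau> \<eta>. S \<in> \<Theta> \<Longrightarrow> S' \<in> \<Theta> \<Longrightarrow> \<tau> \<in> \<Theta> \<Longrightarrow>
      \<eta> \<in> Lp M (pre_sigma \<tau>) p \<Longrightarrow>
      AE \<omega> in M. S \<omega> = S' \<omega> \<longrightarrow> \<rho> S \<tau> \<eta> \<omega> = \<rho> S' \<tau> \<eta> \<omega>"
    and knowledge_preservation: "\<And>S \<tau> \<eta>. S \<in> \<Theta> \<Longrightarrow> \<tau> \<in> \<Theta>_from S \<Longrightarrow>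
      \<eta> \<in> Lp M (pre_sigma S) p \<Longrightarrow> AE \<omega> in M. \<rho> \<tau> S \<eta> \<omega> = \<eta> \<omega>"
    and monotonicity: "\<And>S \<tau> \<eta>\<^sub>1 \<eta>\<^sub>2. S \<in> \<Theta> \<Longrightarrow> \<tau> \<in> \<Theta> \<Longrightarrow>
      \<eta>\<^sub>1 \<in> Lp M (pre_sigma \<tau>) p \<Longrightarrow> \<eta>\<^sub>2 \<in> Lp M (pre_sigma \<tau>) p \<Longrightarrow>
      AE \<omega> in M. \<eta>\<^sub>1 \<omega> \<le> \<eta>\<^sub>2 \<omega> \<Longrightarrow> AE \<omega> in M. \<rho> S \<tau> \<eta>\<^sub>1 \<omega> \<le> \<rho> S \<tau> \<eta>\<^sub>2 \<omega>"
    and consistency: "\<And>S \<sigma> \<tau> \<eta>. S \<in> \<Theta> \<Longrightarrow> \<sigma> \<in> \<Theta>_from S \<Longrightarrow> \<tau> \<in> \<Theta>_from \<sigma> \<Longrightarrow>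
      \<eta> \<in> Lp M (pre_sigma \<tau>) p \<Longrightarrow> AE \<omega> in M. \<rho> S \<sigma> (\<rho> \<sigma> \<tau> \<eta>) \<omega> = \<rho> S \<tau> \<eta> \<omega>"
    and zero_one_law: "\<And>\<xi> S \<tau> \<tau>' A. admissible M F \<Theta> \<xi> \<Longrightarrow> p_integrable M \<Theta> p \<xi> \<Longrightarrow>
      S \<in> \<Theta> \<Longrightarrow> A \<in> sets (pre_sigma S) \<Longrightarrow> \<tau> \<in> \<Theta>_from S \<Longrightarrow> \<tau>' \<in> \<Theta>_from S \<Longrightarrow>
      AE \<omega> in M. \<omega> \<in> A \<longrightarrow> \<tau> \<omega> = \<tau>' \<omega> \<Longrightarrow>
      AE \<omega> in M. \<omega> \<in> A \<longrightarrow> \<rho> S \<tau> (\<xi> \<tau>) \<omega> = \<rho> S \<tau>' (\<xi> \<tau>') \<omega>"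
    and bi_zero_one_law_1: "\<And>\<zeta> \<tau>\<^sub>1 \<tau>\<^sub>1' \<tau>\<^sub>2.
      bi_admissible M F \<Theta> \<zeta> \<Longrightarrow> bi_p_integrable M \<Theta> p \<zeta> \<Longrightarrow>
      \<tau>\<^sub>1 \<in> \<Theta> \<Longrightarrow> \<tau>\<^sub>1' \<in> \<Theta> \<Longrightarrow> \<tau>\<^sub>2 \<in> \<Theta> \<Longrightarrow>
      AE \<omega> in M. \<tau>\<^sub>1 \<omega> = \<tau>\<^sub>1' \<omega> \<longrightarrow>
        \<rho> \<tau>\<^sub>1 (\<lambda>\<omega>. max (\<tau>\<^sub>1 \<omega>) (\<tau>\<^sub>2 \<omega>)) (\<zeta> \<tau>\<^sub>1 \<tau>\<^sub>2) \<omega> =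
        \<rho> \<tau>\<^sub>1' (\<lambda>\<omega>. max (\<tau>\<^sub>1' \<omega>) (\<tau>\<^sub>2 \<omega>)) (\<zeta> \<tau>\<^sub>1' \<tau>\<^sub>2) \<omega>"
    and bi_zero_one_law_2: "\<And>\<zeta> \<tau>\<^sub>1 \<tau>\<^sub>2 \<tau>\<^sub>2'.
      bi_admissible M F \<Theta> \<zeta> \<Longrightarrow> bi_p_integrable M \<Theta> p \<zeta> \<Longrightarrow>
      \<tau>\<^sub>1 \<in> \<Theta> \<Longrightarrow> \<tau>\<^sub>2 \<in> \<Theta> \<Longrightarrow> \<tau>\<^sub>2' \<in> \<Theta> \<Longrightarrow>
      AE \<omega> in M. \<tau>\<^sub>2 \<omega> = \<tau>\<^sub>2' \<omega> \<longrightarrow>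
        \<rho> \<tau>\<^sub>2 (\<lambda>\<omega>. max (\<tau>\<^sub>1 \<omega>) (\<tau>\<^sub>2 \<omega>)) (\<zeta> \<tau>\<^sub>1 \<tau>\<^sub>2) \<omega> =
        \<rho> \<tau>\<^sub>2' (\<lambda>\<omega>. max (\<tau>\<^sub>1 \<omega>) (\<tau>\<^sub>2' \<omega>)) (\<zeta> \<tau>\<^sub>1 \<tau>\<^sub>2') \<omega>"
    and bi_sorted_law: "\<And>\<zeta> \<tau>\<^sub>1 \<tau>\<^sub>2 A m m'.
      bi_admissible M F \<Theta> \<zeta> \<Longrightarrow> bi_p_integrable M \<Theta> p \<zeta> \<Longrightarrow> \<tau>\<^sub>1 \<in> \<Theta> \<Longrightarrow> \<tau>\<^sub>2 \<in> \<Theta> \<Longrightarrow>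
      m = (\<lambda>\<omega>. min (\<tau>\<^sub>1 \<omega>) (\<tau>\<^sub>2 \<omega>)) \<Longrightarrow> m' = (\<lambda>\<omega>. max (\<tau>\<^sub>1 \<omega>) (\<tau>\<^sub>2 \<omega>)) \<Longrightarrow>
      A \<in> sets (pre_sigma m) \<Longrightarrow>
      AE \<omega> in M. \<omega> \<in> A \<longrightarrow> m \<omega> = \<tau>\<^sub>1 \<omega> \<and> m' \<omega> = \<tau>\<^sub>2 \<omega> \<Longrightarrow>
      AE \<omega> in M. \<omega> \<in> A \<longrightarrow>
        \<rho> m m' (\<zeta> m m') \<omega> = \<rho> m m' (\<zeta> \<tau>\<^sub>1 \<tau>\<^sub>2) \<omega> \<and>
        \<rho> m m' (\<zeta> \<tau>\<^sub>1 \<tau>\<^sub>2) \<omega> = \<rho> \<tau>\<^sub>1 m' (\<zeta> \<tau>\<^sub>1 \<tau>\<^sub>2) \<omega> \<and>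
        \<rho> m m' (\<zeta> m' m) \<omega> = \<rho> m m' (\<zeta> \<tau>\<^sub>2 \<tau>\<^sub>1) \<omega> \<and>
        \<rho> m m' (\<zeta> \<tau>\<^sub>2 \<tau>\<^sub>1) \<omega> = \<rho> \<tau>\<^sub>1 m' (\<zeta> \<tau>\<^sub>2 \<tau>\<^sub>1) \<omega>"
    and monotone_Fatou: "\<And>S \<tau> H \<eta>. S \<in> \<Theta> \<Longrightarrow> \<tau> \<in> \<Theta> \<Longrightarrow>
      (\<And>n. H n \<in> Lp M (pre_sigma \<tau>) p) \<Longrightarrow> \<eta> \<in> Lp M (pre_sigma \<tau>) p \<Longrightarrow>
      (\<And>n. AE \<omega> in M. H n \<omega> \<le> H (Suc n) \<omega>) \<Longrightarrow>
      AE \<omega> in M. (\<lambda>n. H n \<omega>) \<longlonglongrightarrow> \<eta> \<omega> \<Longrightarrow>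
      AE \<omega> in M. ereal (\<rho> S \<tau> \<eta> \<omega>) \<le> liminf (\<lambda>n. ereal (\<rho> S \<tau> (H n) \<omega>))"

definition d_property ::
  "'a measure \<Rightarrow> (real \<Rightarrow> 'a measure) \<Rightarrow> ('a \<Rightarrow> real) set \<Rightarrow> ennreal \<Rightarrow>
     (('a \<Rightarrow> real) \<Rightarrow> ('a \<Rightarrow> real) \<Rightarrow> ('a \<Rightarrow> real) \<Rightarrow> 'a \<Rightarrow> real) \<Rightarrow> nat \<Rightarrow> bool" where
  "d_property M F \<Theta> p \<rho> d \<longleftrightarrow>
     (\<forall>\<zeta>. d_admissible M F \<Theta> d \<zeta> \<and> d_p_integrable M \<Theta> p d \<zeta> \<longrightarrow>
       (\<forall>\<tau> \<in> {1..d} \<rightarrow>\<^sub>E \<Theta>. \<forall>\<tau>' \<in> {1..d} \<rightarrow>\<^sub>E \<Theta>. \<forall>A \<in> sets (sigma_at M F (tuple_min {1..d} \<tau>)).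
         (\<forall>i\<in>{1..d}. AE \<omega> in M. \<omega> \<in> A \<longrightarrow> \<tau> i \<omega> = \<tau>' i \<omega>) \<longrightarrow>
         (AE \<omega> in M. \<omega> \<in> A \<longrightarrow>
            \<rho> (tuple_min {1..d} \<tau>) (tuple_max {1..d} \<tau>) (\<zeta> \<tau>) \<omega> =
            \<rho> (tuple_min {1..d} \<tau>') (tuple_max {1..d} \<tau>') (\<zeta> \<tau>') \<omega>)))"

definition strictly_monotone ::
  "'a measure \<Rightarrow> (real \<Rightarrow> 'a measure) \<Rightarrow> ('a \<Rightarrow> real) set \<Rightarrow> ennreal \<Rightarrow>
     (('a \<Rightarrow> real) \<Rightarrow> ('a \<Rightarrow> real) \<Rightarrow> ('a \<Rightarrow> real) \<Rightarrow> 'a \<Rightarrow> real) \<Rightarrow> bool" where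
  "strictly_monotone M F \<Theta> p \<rho> \<longleftrightarrow>
     (\<forall>S\<in>\<Theta>. \<forall>\<tau>\<in>times_from M \<Theta> S.
       \<forall>\<eta>\<^sub>1\<in>Lp M (sigma_at M F \<tau>) p. \<forall>\<eta>\<^sub>2\<in>Lp M (sigma_at M F \<tau>) p.
         (AE \<omega> in M. \<eta>\<^sub>1 \<omega> \<le> \<eta>\<^sub>2 \<omega>) \<longrightarrow> (AE \<omega> in M. \<rho> S \<tau> \<eta>\<^sub>1 \<omega> = \<rho> S \<tau> \<eta>\<^sub>2 \<omega>) \<longrightarrow>
         (AE \<omega> in M. \<eta>\<^sub>1 \<omega> = \<eta>\<^sub>2 \<omega>))"

section \<open>Value families of the multiple stopping problem\<close>

text \<open>Essential suprema are taken in the extended reals, so that finiteness of a value family is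
  never built into its definition.\<close>

definition value_V ::
  "'a measure \<Rightarrow> ('a \<Rightarrow> real) set \<Rightarrow>
     (('a \<Rightarrow> real) \<Rightarrow> ('a \<Rightarrow> real) \<Rightarrow> ('a \<Rightarrow> real) \<Rightarrow> 'a \<Rightarrow> real) \<Rightarrow> nat \<Rightarrow>
     ((nat \<Rightarrow> 'a \<Rightarrow> real) \<Rightarrow> 'a \<Rightarrow> real) \<Rightarrow> ('a \<Rightarrow> real) \<Rightarrow> 'a \<Rightarrow> ereal" where
  "value_V M \<Theta> \<rho> d \<psi> S =
     ess_sup_family M ({1..d} \<rightarrow>\<^sub>E times_from M \<Theta> S)
       (\<lambda>\<tau> \<omega>. ereal (\<rho> S (tuple_max {1..d} \<tau>) (\<psi> \<tau>) \<omega>))"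

text \<open>A \<open>(d-1)\<close>-tuple with the \<open>i\<close>-th entry missing is a function on \<open>{1..d} - {i}\<close>.\<close>

definition value_ui ::
  "'a measure \<Rightarrow> ('a \<Rightarrow> real) set \<Rightarrow>
     (('a \<Rightarrow> real) \<Rightarrow> ('a \<Rightarrow> real) \<Rightarrow> ('a \<Rightarrow> real) \<Rightarrow> 'a \<Rightarrow> real) \<Rightarrow> nat \<Rightarrow>
     ((nat \<Rightarrow> 'a \<Rightarrow> real) \<Rightarrow> 'a \<Rightarrow> real) \<Rightarrow> nat \<Rightarrow> ('a \<Rightarrow> real) \<Rightarrow> 'a \<Rightarrow> ereal" where
  "value_ui M \<Theta> \<rho> d \<psi> i S =
     ess_sup_family M (({1..d} - {i}) \<rightarrow>\<^sub>E times_from M \<Theta> S)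
       (\<lambda>\<tau> \<omega>. ereal (\<rho> S (tuple_max {1..d} (\<tau>(i := S))) (\<psi> (\<tau>(i := S))) \<omega>))"

definition reward_phi ::
  "'a measure \<Rightarrow> ('a \<Rightarrow> real) set \<Rightarrow>
     (('a \<Rightarrow> real) \<Rightarrow> ('a \<Rightarrow> real) \<Rightarrow> ('a \<Rightarrow> real) \<Rightarrow> 'a \<Rightarrow> real) \<Rightarrow> nat \<Rightarrow>
     ((nat \<Rightarrow> 'a \<Rightarrow> real) \<Rightarrow> 'a \<Rightarrow> real) \<Rightarrow> ('a \<Rightarrow> real) \<Rightarrow> 'a \<Rightarrow> ereal" where
  "reward_phi M \<Theta> \<rho> d \<psi> S \<omega> = Max ((\<lambda>i. value_ui M \<Theta> \<rho> d \<psi> i S \<omega>) ` {1..d})"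

text \<open>The operators act on real-valued functions, hence the coercion below. If the values
  \<open>value_V\<close> are in \<open>Lp\<close> then \<open>reward_phi\<close> is almost surely finite: it lies between
  \<open>\<rho>\<close> applied to the diagonal of \<open>\<psi>\<close> and \<open>value_V\<close>.\<close>

definition value_u ::
  "'a measure \<Rightarrow> ('a \<Rightarrow> real) set \<Rightarrow>
     (('a \<Rightarrow> real) \<Rightarrow> ('a \<Rightarrow> real) \<Rightarrow> ('a \<Rightarrow> real) \<Rightarrow> 'a \<Rightarrow> real) \<Rightarrow> nat \<Rightarrow>
     ((nat \<Rightarrow> 'a \<Rightarrow> real) \<Rightarrow> 'a \<Rightarrow> real) \<Rightarrow> ('a \<Rightarrow> real) \<Rightarrow> 'a \<Rightarrow> ereal" where
  "value_u M \<Theta> \<rho> d \<psi> S =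
     ess_sup_family M (times_from M \<Theta> S)
       (\<lambda>\<tau> \<omega>. ereal (\<rho> S \<tau> (\<lambda>\<omega>'. real_of_ereal (reward_phi M \<Theta> \<rho> d \<psi> \<tau> \<omega>')) \<omega>))"

end

theory Submission
  imports Defs
begin

text \<open>Write \<open>gain R \<sigma>\<close> for \<open>\<rho>\<close> at \<open>R\<close> of the payoff of the tuple \<open>\<sigma>\<close>. The idea is to stop
  twice: at the smallest time of a tuple, and then at the others.

  The link between the two stages is that \<open>\<phi> R\<close> is the essential supremum of \<open>gain R \<sigma>\<close> over
  the tuples \<open>\<sigma>\<close> whose minimum is \<open>R\<close> (\<open>ess_sup_phi\<close>). Indeed at almost every point some entry of
  such a \<open>\<sigma>\<close> equals \<open>R\<close>; where this is the \<open>i\<close>-th one, the d-property allows to replace it by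
  \<open>R\<close>, so that the gain is bounded by the value \<open>u\<^sub>i\<close>. Two tuples with minimum \<open>R\<close> can
  be glued along an event known at \<open>R\<close>, and by the d-property the gain of the glued tuple is the
  glued gain. Hence the gains form an upward directed family, and \<open>\<phi> R\<close> is the limit of an increasing
  sequence of them (\<open>phi_limit_of_gains\<close>). By the monotone Fatou property and consistency,
  \<open>\<rho> S R\<close> of \<open>\<phi> R\<close> is at most the lower limit of the gains of these tuples at \<open>S\<close>, hence at
  most \<open>V S\<close> (\<open>rho_phi_le_V\<close>); so \<open>u S \<le> V S\<close>.

  If \<open>\<tau>\<close> is optimal for \<open>V S\<close> and \<open>m\<close> is its minimum, then consistency and monotonicity close
  the circle:
  \<open>V S = gain S \<tau> = \<rho> S m (gain m \<tau>) \<le> \<rho> S m (\<phi> m) \<le> u S \<le> V S\<close>.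
  All terms are thus equal, which is the first claim. If \<open>\<rho>\<close> is strictly monotone, the equality
  of the third and fourth terms gives \<open>gain m \<tau> = \<phi> m\<close>. Where \<open>\<tau> i = m\<close>, the gain of \<open>\<tau>\<close> is the
  gain with \<open>\<tau> i\<close> replaced by \<open>m\<close>, which is at most \<open>u\<^sub>i i m \<le> \<phi> m\<close>; so these agree too,
  which is the second claim.\<close>

section \<open>Essential suprema of directed families and the spaces Lp\<close>

lemma is_ess_sup_upper: "is_ess_sup M I X Z \<Longrightarrow> i \<in> I \<Longrightarrow> AE \<omega> in M. X i \<omega> \<le> Z \<omega>"
  by (simp add: is_ess_sup_def)

lemma is_ess_sup_least:
  "is_ess_sup M I X Z \<Longrightarrow> Y \<in> borel_measurable M \<Longrightarrow> (\<And>i. i \<in> I \<Longrightarrow> AE \<omega> in M. X i \<omega> \<le> Y \<omega>) \<Longrightarrow>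
    AE \<omega> in M. Z \<omega> \<le> Y \<omega>"
  by (simp add: is_ess_sup_def)

text \<open>Choose members whose integrals of \<open>arctan (X i)\<close> approach the supremum of all
  such integrals, and use directedness to make them increasing. No further member can exceed the
  supremum of the sequence on a set of positive measure, since a common upper bound of it and of
  late members of the sequence would have too large an integral. The function \<open>arctan\<close> makes
  the integrals exist without losing strict monotonicity.\<close>

lemma (in finite_measure) directed_family_countable_sup:
  fixes X :: "'i \<Rightarrow> 'a \<Rightarrow> real"
  assumes ne: "I \<noteq> {}"
    and X[measurable]: "\<And>i. i \<in> I \<Longrightarrow> X i \<in> borel_measurable M"
    and dir: "\<And>i j. i \<in> I \<Longrightarrow> j \<in> I \<Longrightarrow>
      \<exists>k\<in>I. AE \<omega> in M. X i \<omega> \<le> X k \<omega> \<and> X j \<omega> \<le> X k \<omega>"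
  shows "\<exists>s :: nat \<Rightarrow> 'i. (\<forall>n. s n \<in> I) \<and>
    (\<forall>n. AE \<omega> in M. X (s n) \<omega> \<le> X (s (Suc n)) \<omega>) \<and>
    (\<forall>i\<in>I. AE \<omega> in M. ereal (X i \<omega>) \<le> (SUP n. ereal (X (s n) \<omega>)))"
proof -
  define G where "G i = (\<integral>\<omega>. arctan (X i \<omega>) \<partial>M)" for i
  have bd: "\<bar>arctan r\<bar> \<le> 2" for r
    using arctan_bounded[of r] pi_less_4 by linarith
  have int: "integrable M (\<lambda>\<omega>. arctan (X i \<omega>))" if "i \<in> I" for i
    by (rule integrable_const_bound[where B=2]) (use bd that in auto)
  have "G i \<le> (\<integral>\<omega>. 2 \<partial>M)" if "i \<in> I" for i
    unfolding G_def by (rule integral_mono) (use int[OF that] bd in \<open>auto simp: abs_le_iff\<close>)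
  then have bdd: "bdd_above (G ` I)" by (auto intro!: bdd_aboveI)
  define c where "c = (SUP i\<in>I. G i)"
  have Gc: "G i \<le> c" if "i \<in> I" for i
    unfolding c_def using that bdd by (rule cSUP_upper)
  have "\<exists>i\<in>I. c - 1 / real (Suc n) < G i" for n
    using less_cSUP_iff[OF ne bdd, of "c - 1 / real (Suc n)"] by (simp add: c_def)
  then obtain j where j: "\<And>n. j n \<in> I" "\<And>n. c - 1 / real (Suc n) < G (j n)"
    by metis
  have "\<exists>s. \<forall>n. s n \<in> I \<and> ((AE \<omega> in M. X (s n) \<omega> \<le> X (s (Suc n)) \<omega>) \<and>
      (AE \<omega> in M. X (j n) \<omega> \<le> X (s (Suc n)) \<omega>))"
  proof (rule dependent_nat_choice)
    show "\<exists>x. x \<in> I" using ne by auto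
  next
    fix x n assume "x \<in> I"
    from dir[OF this j(1)[of n]] show "\<exists>y. y \<in> I \<and> ((AE \<omega> in M. X x \<omega> \<le> X y \<omega>) \<and>
      (AE \<omega> in M. X (j n) \<omega> \<le> X y \<omega>))" by auto
  qed
  then obtain s where s: "\<And>n. s n \<in> I" "\<And>n. AE \<omega> in M. X (s n) \<omega> \<le> X (s (Suc n)) \<omega>"
    "\<And>n. AE \<omega> in M. X (j n) \<omega> \<le> X (s (Suc n)) \<omega>" by blast
  have Gs: "c - 1 / real (Suc n) < G (s (Suc n))" for n
  proof -
    have "G (j n) \<le> G (s (Suc n))" unfolding G_def
      by (intro integral_mono_AE int s j) (use s(3)[of n] in \<open>auto simp: arctan_le_iff\<close>)
    then show ?thesis using j(2)[of n] by linarith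
  qed
  have "AE \<omega> in M. ereal (X i \<omega>) \<le> (SUP n. ereal (X (s n) \<omega>))" if i: "i \<in> I" for i
  proof -
    note [measurable] = X[OF i] X[OF s(1)]
    \<comment> \<open>The truncation of negative values by \<open>ennreal\<close> makes \<open>e\<close> the positive part of the excess.\<close>
    define e where "e n \<omega> = ennreal (arctan (X i \<omega>) - arctan (X (s (Suc n)) \<omega>))" for n \<omega>
    have e_meas[measurable]: "e n \<in> borel_measurable M" for n unfolding e_def by measurable
    have e_le: "(\<integral>\<^sup>+\<omega>. e n \<omega> \<partial>M) \<le> ennreal (1 / real (Suc n))" for n
    proof -
      obtain k where k: "k \<in> I" "AE \<omega> in M. X i \<omega> \<le> X k \<omega> \<and> X (s (Suc n)) \<omega> \<le> X k \<omega>"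
        using dir[OF i s(1)] by blast
      have "(\<integral>\<^sup>+\<omega>. e n \<omega> \<partial>M) \<le> (\<integral>\<^sup>+\<omega>. ennreal (arctan (X k \<omega>) - arctan (X (s (Suc n)) \<omega>)) \<partial>M)"
        unfolding e_def
        by (rule nn_integral_mono_AE) (use k(2) in \<open>auto intro!: ennreal_leI simp: arctan_le_iff\<close>)
      also have "\<dots> = ennreal (\<integral>\<omega>. arctan (X k \<omega>) - arctan (X (s (Suc n)) \<omega>) \<partial>M)"
        by (rule nn_integral_eq_integral)
          (use k in \<open>auto intro!: int s simp: arctan_le_iff\<close>)
      also have "(\<integral>\<omega>. arctan (X k \<omega>) - arctan (X (s (Suc n)) \<omega>) \<partial>M) = G k - G (s (Suc n))"
        unfolding G_def by (intro Bochner_Integration.integral_diff int k s)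
      also have "ennreal \<dots> \<le> ennreal (1 / real (Suc n))"
        using Gc[OF k(1)] Gs[of n] by (intro ennreal_leI) linarith
      finally show ?thesis .
    qed
    have "(\<integral>\<^sup>+\<omega>. (INF n. e n \<omega>) \<partial>M) \<le> ennreal r" if r: "r > 0" for r
    proof -
      obtain n where n: "1 / real (Suc n) < r" using r by (rule nat_approx_posE)
      have "(\<integral>\<^sup>+\<omega>. (INF n. e n \<omega>) \<partial>M) \<le> (\<integral>\<^sup>+\<omega>. e n \<omega> \<partial>M)"
        by (intro nn_integral_mono INF_lower) auto
      also note e_le[of n]
      also have "ennreal (1 / real (Suc n)) \<le> ennreal r" using n by (intro ennreal_leI) auto
      finally show ?thesis .
    qed
    then have "(\<integral>\<^sup>+\<omega>. (INF n. e n \<omega>) \<partial>M) = 0"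
      by (metis ennreal_le_epsilon add.left_neutral le_zero_eq)
    then have "AE \<omega> in M. (INF n. e n \<omega>) = 0"
      by (subst (asm) nn_integral_0_iff_AE) auto
    then show ?thesis
    proof eventually_elim
      case (elim \<omega>)
      show ?case
      proof (rule ccontr)
        assume "\<not> ?thesis"
        then obtain r where r: "(SUP n. ereal (X (s n) \<omega>)) < ereal r" "r < X i \<omega>"
          using ereal_dense3[of "SUP n. ereal (X (s n) \<omega>)" "ereal (X i \<omega>)"]
          by (auto simp: not_le)
        have "X (s n) \<omega> < r" for n
          using r(1) SUP_upper[of n UNIV "\<lambda>n. ereal (X (s n) \<omega>)"] by (metis UNIV_I le_less_trans less_ereal.simps(1))
        then have "ennreal (arctan (X i \<omega>) - arctan r) \<le> (INF n. e n \<omega>)"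
          unfolding e_def by (intro INF_greatest ennreal_leI) (simp add: arctan_le_iff less_imp_le)
        moreover have "arctan r < arctan (X i \<omega>)" using r(2) by (simp add: arctan_less_iff)
        ultimately show False using elim by simp
      qed
    qed
  qed
  then show ?thesis using s(1,2) by blast
qed

text \<open>The essential suprema in the value families are only known to be measurable and to lie
  between integrable bounds; this is how they enter \<open>Lp\<close>.\<close>

lemma Lp_between:
  assumes f: "f \<in> Lp M M p" and g: "g \<in> Lp M M p"
    and h: "h \<in> borel_measurable G" and hM[measurable]: "h \<in> borel_measurable M"
    and le: "AE \<omega> in M. f \<omega> \<le> h \<omega> \<and> h \<omega> \<le> g \<omega>"
  shows "h \<in> Lp M G p"
proof (cases "p = \<infinity>")
  case True
  have [measurable]: "f \<in> borel_measurable M" "g \<in> borel_measurable M"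
    using f g by (auto simp: Lp_def)
  define e where "e = max (esssup M (\<lambda>\<omega>. ereal \<bar>f \<omega>\<bar>)) (esssup M (\<lambda>\<omega>. ereal \<bar>g \<omega>\<bar>))"
  have "AE \<omega> in M. ereal \<bar>h \<omega>\<bar> \<le> e"
    using le esssup_AE[of "\<lambda>\<omega>. ereal \<bar>f \<omega>\<bar>" M] esssup_AE[of "\<lambda>\<omega>. ereal \<bar>g \<omega>\<bar>" M]
  proof eventually_elim
    case (elim \<omega>)
    then have "ereal \<bar>h \<omega>\<bar> \<le> max (ereal \<bar>f \<omega>\<bar>) (ereal \<bar>g \<omega>\<bar>)"
      by (auto simp: max_def)
    also have "\<dots> \<le> e" unfolding e_def using elim by (intro max.mono)
    finally show ?case .
  qed
  then have "esssup M (\<lambda>\<omega>. ereal \<bar>h \<omega>\<bar>) \<le> e" by (intro esssup_I) auto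
  also have "e < \<infinity>" using f g True by (auto simp: e_def Lp_def max_def)
  finally show ?thesis using h True by (simp add: Lp_def)
next
  case False
  define q where "q = enn2real p"
  have q: "q \<ge> 0" by (simp add: q_def)
  have "integrable M (\<lambda>\<omega>. \<bar>h \<omega>\<bar> powr q)"
  proof (rule Bochner_Integration.integrable_bound)
    show "integrable M (\<lambda>\<omega>. \<bar>f \<omega>\<bar> powr q + \<bar>g \<omega>\<bar> powr q)"
      using f g False by (auto simp: Lp_def q_def)
    show "AE \<omega> in M. norm (\<bar>h \<omega>\<bar> powr q) \<le> norm (\<bar>f \<omega>\<bar> powr q + \<bar>g \<omega>\<bar> powr q)"
      using le
    proof eventually_elim
      case (elim \<omega>)
      then have "\<bar>h \<omega>\<bar> powr q \<le> max \<bar>f \<omega>\<bar> \<bar>g \<omega>\<bar> powr q"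
        using q by (intro powr_mono2) auto
      also have "\<dots> \<le> \<bar>f \<omega>\<bar> powr q + \<bar>g \<omega>\<bar> powr q"
        by (simp add: max_def)
      finally show ?case by simp
    qed
  qed simp
  then show ?thesis using h False by (simp add: Lp_def q_def)
qed

lemma tuple_min_le: "finite I \<Longrightarrow> i \<in> I \<Longrightarrow> tuple_min I \<sigma> \<omega> \<le> \<sigma> i \<omega>"
  by (simp add: tuple_min_def)

lemma le_tuple_max: "finite I \<Longrightarrow> i \<in> I \<Longrightarrow> \<sigma> i \<omega> \<le> tuple_max I \<sigma> \<omega>"
  by (simp add: tuple_max_def)

section \<open>Information at bounded stopping times\<close>

context bermudan_setting
begin

abbreviation bounded_time :: "('a \<Rightarrow> real) \<Rightarrow> bool" where
  "bounded_time R \<equiv> stopping_time F R \<and> R \<in> space M \<rightarrow> {0..T}"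

lemma null_sets_pre_sigma:
  assumes R: "bounded_time R" and N: "N \<in> null_sets M"
  shows "N \<in> sets (pre_sigma R)"
proof (rule sets_pre_sigmaI)
  fix t
  show "{\<omega> \<in> N. R \<omega> \<le> t} \<in> sets (F t)"
  \<comment> \<open>Null sets are only known to lie in \<open>F t\<close> for \<open>t \<ge> 0\<close>, but \<open>R\<close> is never negative.\<close>
  proof (cases "t < 0")
    case True
    have "N \<subseteq> space M" using N by (auto dest: sets.sets_into_space)
    then have "{\<omega> \<in> N. R \<omega> \<le> t} = {}" using R True by (force simp: Pi_iff)
    then show ?thesis by (metis sets.empty_sets)
  next
    case False
    have "{\<omega> \<in> N. R \<omega> \<le> t} \<in> null_sets M"
      by (rule complete2[OF _ N]) auto
    then show ?thesis using complete_F sets_F_mono[of 0 t] False by auto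
  qed
qed (use R in auto)

lemma sets_pre_sigma_AE_cong:
  assumes R: "bounded_time R" and A: "A \<in> sets (pre_sigma R)" and B: "B \<subseteq> space M"
    and eq: "AE \<omega> in M. \<omega> \<in> A \<longleftrightarrow> \<omega> \<in> B"
  shows "B \<in> sets (pre_sigma R)"
proof -
  obtain N where N: "N \<in> null_sets M" "{\<omega> \<in> space M. \<not> (\<omega> \<in> A \<longleftrightarrow> \<omega> \<in> B)} \<subseteq> N"
    using eq by (auto elim!: AE_E3)
  have "A - N \<in> sets (pre_sigma R)" using A null_sets_pre_sigma[OF R N(1)] by auto
  moreover have "B \<inter> N \<in> sets (pre_sigma R)"
    by (rule null_sets_pre_sigma[OF R complete2[OF _ N(1)]]) auto
  moreover have "B = (A - N) \<union> (B \<inter> N)"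
    using N(2) B sets.sets_into_space[OF A] by (auto simp: space_pre_sigma)
  ultimately show ?thesis by (metis sets.Un)
qed


lemma borel_measurable_pre_sigma_AE_cong:
  assumes R: "bounded_time R" and f: "f \<in> borel_measurable (pre_sigma R)"
    and eq: "AE \<omega> in M. f \<omega> = g \<omega>"
  shows "g \<in> borel_measurable (pre_sigma R)"
proof (rule measurableI)
  fix B :: "'b set" assume "B \<in> sets borel"
  with f have "f -` B \<inter> space M \<in> sets (pre_sigma R)"
    by (auto dest: measurable_sets simp: space_pre_sigma)
  then have "g -` B \<inter> space M \<in> sets (pre_sigma R)"
    by (rule sets_pre_sigma_AE_cong[OF R]) (use eq in auto)
  then show "g -` B \<inter> space (pre_sigma R) \<in> sets (pre_sigma R)"
    by (simp add: space_pre_sigma)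
qed simp

text \<open>The order between the times of a tuple holds only almost surely. The pointwise maximum of
  \<open>R\<close> and \<open>Q\<close> dominates \<open>R\<close> everywhere and carries the same information as \<open>Q\<close> on the event
  \<open>R \<le> Q\<close>, whose complement is null and hence known at \<open>Q\<close>.\<close>

lemma pre_sigma_mono_AE:
  assumes R: "bounded_time R" and Q: "bounded_time Q" and le: "AE \<omega> in M. R \<omega> \<le> Q \<omega>"
  shows "sets (pre_sigma R) \<subseteq> sets (pre_sigma Q)"
proof
  fix A assume A: "A \<in> sets (pre_sigma R)"
  let ?P = "\<lambda>\<omega>. max (R \<omega>) (Q \<omega>)"
  have P: "bounded_time ?P" using R Q by (auto intro: stopping_time_max simp: Pi_iff)
  have AP: "A \<in> sets (pre_sigma ?P)"
    using mono_pre_sigma[of R ?P] R P A by auto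
  have "A \<inter> {\<omega> \<in> space M. R \<omega> \<le> Q \<omega>} \<in> sets (pre_sigma Q)"
  proof (rule sets_pre_sigmaI)
    fix t
    have "{\<omega> \<in> A. ?P \<omega> \<le> t} \<in> sets (F t)" using sets_pre_sigmaD[OF _ AP] P by blast
    moreover have "Measurable.pred (pre_sigma Q) (\<lambda>\<omega>. \<not> Q \<omega> < R \<omega>)"
      using R Q by (intro pred_intros_logic stopping_time_less) auto
    then have "{\<omega> \<in> {\<omega> \<in> space M. R \<omega> \<le> Q \<omega>}. Q \<omega> \<le> t} \<in> sets (F t)"
      using Q by (intro sets_pre_sigmaD[of Q]) (auto simp: pred_def space_pre_sigma not_less)
    ultimately have "{\<omega> \<in> A. ?P \<omega> \<le> t} \<inter> {\<omega> \<in> {\<omega> \<in> space M. R \<omega> \<le> Q \<omega>}. Q \<omega> \<le> t} \<in> sets (F t)"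
      by auto
    also have "{\<omega> \<in> A. ?P \<omega> \<le> t} \<inter> {\<omega> \<in> {\<omega> \<in> space M. R \<omega> \<le> Q \<omega>}. Q \<omega> \<le> t} =
        {\<omega> \<in> A \<inter> {\<omega> \<in> space M. R \<omega> \<le> Q \<omega>}. Q \<omega> \<le> t}"
      by auto
    finally show "{\<omega> \<in> A \<inter> {\<omega> \<in> space M. R \<omega> \<le> Q \<omega>}. Q \<omega> \<le> t} \<in> sets (F t)" .
  qed (use Q in auto)
  then show "A \<in> sets (pre_sigma Q)"
    by (rule sets_pre_sigma_AE_cong[OF Q])
      (use le sets.sets_into_space[OF A] in \<open>auto simp: space_pre_sigma\<close>)
qed

lemma pre_sigma_le_F_T:
  assumes R: "bounded_time R" shows "sets (pre_sigma R) \<subseteq> sets (F T)"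
proof
  fix A assume A: "A \<in> sets (pre_sigma R)"
  have "{\<omega> \<in> A. R \<omega> \<le> T} = A"
    using R sets.sets_into_space[OF A] by (auto simp: space_pre_sigma)
  then show "A \<in> sets (F T)" using sets_pre_sigmaD[OF _ A, of T] R by simp
qed

lemma subalgebra_pre_sigma: "bounded_time R \<Longrightarrow> subalgebra M (pre_sigma R)"
  using pre_sigma_le_F_T[of R] subalgebra_F[of T] by (auto simp: subalgebra_def space_pre_sigma)

lemma Lp_pre_sigma_imp_Lp:
  assumes R: "bounded_time R" and f: "f \<in> Lp M (pre_sigma R) p"
  shows "f \<in> borel_measurable M" "f \<in> Lp M M p"
proof -
  show m: "f \<in> borel_measurable M"
    using f by (intro measurable_from_subalg[OF subalgebra_pre_sigma[OF R]])
      (simp add: Lp_def)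
  show "f \<in> Lp M M p" using f m unfolding Lp_def by blast
qed

lemma stopping_time_greater:
  assumes R: "stopping_time F R" and Q: "stopping_time F Q"
  shows "Measurable.pred (pre_sigma R) (\<lambda>\<omega>. Q \<omega> < R \<omega>)"
proof (rule pred_pre_sigmaI[OF R])
  fix t
  have "{\<omega> \<in> {\<omega> \<in> space M. Q \<omega> < R \<omega>}. Q \<omega> \<le> t} \<in> sets (F t)"
    using stopping_time_less[OF Q R] by (intro sets_pre_sigmaD[OF Q]) (auto simp: pred_def space_pre_sigma)
  moreover have "{\<omega> \<in> space M. R \<omega> \<le> t} \<in> sets (F t)"
    using stopping_timeD[OF R] by (simp add: pred_def space_F)
  ultimately have "{\<omega> \<in> {\<omega> \<in> space M. Q \<omega> < R \<omega>}. Q \<omega> \<le> t} \<inter> {\<omega> \<in> space M. R \<omega> \<le> t} \<in> sets (F t)"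
    by auto
  also have "{\<omega> \<in> {\<omega> \<in> space M. Q \<omega> < R \<omega>}. Q \<omega> \<le> t} \<inter> {\<omega> \<in> space M. R \<omega> \<le> t} =
      {\<omega> \<in> space M. Q \<omega> < R \<omega> \<and> R \<omega> \<le> t}" by auto
  finally show "Measurable.pred (F t) (\<lambda>\<omega>. Q \<omega> < R \<omega> \<and> R \<omega> \<le> t)"
    by (simp add: pred_def space_F)
qed

lemma stopping_time_eq_pre_sigma:
  assumes R: "stopping_time F R" and Q: "stopping_time F Q"
  shows "{\<omega> \<in> space M. R \<omega> = Q \<omega>} \<in> sets (pre_sigma R)"
proof -
  have "Measurable.pred (pre_sigma R) (\<lambda>\<omega>. \<not> Q \<omega> < R \<omega> \<and> \<not> R \<omega> < Q \<omega>)"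
    using stopping_time_greater[OF R Q] stopping_time_less[OF R Q] by measurable
  moreover have "(\<lambda>\<omega>. \<not> Q \<omega> < R \<omega> \<and> \<not> R \<omega> < Q \<omega>) = (\<lambda>\<omega>. R \<omega> = Q \<omega>)"
    by (auto simp: fun_eq_iff)
  ultimately show ?thesis by (simp add: pred_def space_pre_sigma)
qed

section \<open>Closure properties of Bermudan stopping times\<close>

text \<open>The partition in the definition of \<open>bermudan_times\<close> can be reconstructed from the time
  itself: the event that \<open>k\<close> is the first index with \<open>\<tau> = \<theta> k\<close> is known at \<open>\<theta> k\<close>, since on
  \<open>\<tau> = \<theta> k\<close> an earlier coincidence \<open>\<tau> = \<theta> j\<close> means \<open>\<theta> k = \<theta> j\<close>. In this form the closure of the
  Bermudan times under maxima, minima and gluing is pointwise.\<close>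

lemma bermudan_times_iff:
  "\<tau> \<in> \<Theta> \<longleftrightarrow> bounded_time \<tau> \<and> (AE \<omega> in M. \<tau> \<omega> = T \<or> (\<exists>k. \<tau> \<omega> = \<theta> k \<omega>))"
proof safe
  assume \<tau>: "\<tau> \<in> \<Theta>"
  then obtain A A' where A: "disjoint_family A" "\<And>k. A k \<inter> A' = {}" "(\<Union>k. A k) \<union> A' = space M"
    "AE \<omega> in M. \<tau> \<omega> = (\<Sum>k. \<theta> k \<omega> * indicator (A k) \<omega>) + T * indicator A' \<omega>"
    by (auto simp: bermudan_times_def)
  show "AE \<omega> in M. \<tau> \<omega> = T \<or> (\<exists>k. \<tau> \<omega> = \<theta> k \<omega>)"
    using A(4) AE_space
  proof eventually_elim
    case (elim \<omega>)
    show ?case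
    proof (cases "\<omega> \<in> A'")
      case True
      then have "(\<lambda>k. \<theta> k \<omega> * indicator (A k) \<omega>) = (\<lambda>k. 0)"
        using A(2) by (auto simp: fun_eq_iff indicator_def)
      then show ?thesis using elim True by simp
    next
      case False
      with elim A(3) obtain k where k: "\<omega> \<in> A k" by blast
      have "indicator (A j) \<omega> = (if j = k then 1 else 0 :: real)" for j
        using A(1) k by (auto simp: disjoint_family_on_def indicator_def)
      then have "(\<Sum>j. \<theta> j \<omega> * indicator (A j) \<omega>) = (\<Sum>j\<in>{k}. \<theta> j \<omega> * indicator (A j) \<omega>)"
        by (intro suminf_finite) auto
      then show ?thesis using elim False k by auto
    qed
  qed
next
  assume st: "stopping_time F \<tau>" and range: "\<tau> \<in> space M \<rightarrow> {0..T}"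
    and AE: "AE \<omega> in M. \<tau> \<omega> = T \<or> (\<exists>k. \<tau> \<omega> = \<theta> k \<omega>)"
  define E where "E k = {\<omega> \<in> space M. \<tau> \<omega> = \<theta> k \<omega>}" for k
  define A' where "A' = space M - (\<Union>k. E k)"
  have E: "E k \<in> sets (pre_sigma (\<theta> k))" for k
    unfolding E_def using stopping_time_eq_pre_sigma[OF stopping_time_\<theta>[of k] st]
    by (simp add: eq_commute)
  have dE: "disjointed E k \<in> sets (pre_sigma (\<theta> k))" for k
  proof -
    have "disjointed E k = E k - (\<Union>j\<in>{0..<k}. {\<omega> \<in> space M. \<theta> k \<omega> = \<theta> j \<omega>})"
      by (auto simp: disjointed_def E_def)
    also have "\<dots> \<in> sets (pre_sigma (\<theta> k))"
      by (intro sets.Diff E sets.finite_UN stopping_time_eq_pre_sigma stopping_time_\<theta>) auto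
    finally show ?thesis .
  qed
  have "E k \<in> sets (F T)" for k
    using pre_sigma_le_F_T[of "\<theta> k"] stopping_time_\<theta> range_\<theta> E by blast
  then have A': "A' \<in> sets (F T)"
    unfolding A'_def using sets.compl_sets[of "\<Union>k. E k" "F T"] by (simp add: space_F sets.countable_UN')
  have "AE \<omega> in M. \<tau> \<omega> = (\<Sum>k. \<theta> k \<omega> * indicator (disjointed E k) \<omega>) + T * indicator A' \<omega>"
    using AE AE_space
  proof eventually_elim
    case (elim \<omega>)
    show ?case
    proof (cases "\<omega> \<in> A'")
      case True
      then have "\<tau> \<omega> = T" using elim by (auto simp: A'_def E_def)
      moreover have "\<omega> \<notin> disjointed E k" for k
        using True by (auto simp: A'_def disjointed_def)
      ultimately show ?thesis using True by simp
    next
      case False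
      with elim have "\<omega> \<in> (\<Union>k. disjointed E k)"
        unfolding UN_disjointed_eq by (auto simp: A'_def)
      then obtain k where k: "\<omega> \<in> disjointed E k" by blast
      have "indicator (disjointed E j) \<omega> = (if j = k then 1 else 0 :: real)" for j
        using disjoint_family_disjointed[of E] k by (auto simp: disjoint_family_on_def indicator_def)
      then have "(\<Sum>j. \<theta> j \<omega> * indicator (disjointed E j) \<omega>) = (\<Sum>j\<in>{k}. \<theta> j \<omega> * indicator (disjointed E j) \<omega>)"
        by (intro suminf_finite) auto
      moreover have "\<tau> \<omega> = \<theta> k \<omega>" using k by (auto simp: disjointed_def E_def)
      ultimately show ?thesis using False k by simp
    qed
  qed
  moreover have "(\<Union>k. disjointed E k) \<union> A' = space M"
    unfolding UN_disjointed_eq by (auto simp: A'_def E_def)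
  moreover have "disjointed E k \<inter> A' = {}" for k
    by (auto simp: A'_def disjointed_def)
  ultimately show "\<tau> \<in> \<Theta>"
    unfolding bermudan_times_def using st range dE A' disjoint_family_disjointed[of E] by blast
qed (auto simp: bermudan_times_def)

lemma bounded_time_bermudan: "\<tau> \<in> \<Theta> \<Longrightarrow> bounded_time \<tau>"
  by (simp add: bermudan_times_iff)

lemma times_fromD: "\<nu> \<in> \<Theta>_from R \<Longrightarrow> \<nu> \<in> \<Theta>"
  by (simp add: times_from_def)

lemma tuples_fromD: "\<sigma> \<in> I \<rightarrow>\<^sub>E \<Theta>_from R \<Longrightarrow> \<sigma> \<in> I \<rightarrow>\<^sub>E \<Theta>"
  by (auto simp: PiE_iff times_fromD)

lemma tuple_max_bermudan:
  assumes I: "finite I" "I \<noteq> {}" and \<sigma>: "\<And>i. i \<in> I \<Longrightarrow> \<sigma> i \<in> \<Theta>"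
  shows "tuple_max I \<sigma> \<in> \<Theta>"
proof -
  have mem: "tuple_max I \<sigma> \<omega> \<in> (\<lambda>i. \<sigma> i \<omega>) ` I" for \<omega>
    unfolding tuple_max_def using I by (intro Max_in) auto
  have "AE \<omega> in M. \<forall>i\<in>I. \<sigma> i \<omega> = T \<or> (\<exists>k. \<sigma> i \<omega> = \<theta> k \<omega>)"
    using \<sigma> I by (intro AE_finite_allI) (auto simp: bermudan_times_iff)
  then have "AE \<omega> in M. tuple_max I \<sigma> \<omega> = T \<or> (\<exists>k. tuple_max I \<sigma> \<omega> = \<theta> k \<omega>)"
    by eventually_elim (use mem in fastforce)
  moreover have "Measurable.pred (F t) (\<lambda>\<omega>. \<forall>i\<in>I. \<sigma> i \<omega> \<le> t)" for t
    using \<sigma> I by (intro pred_intros_finite stopping_timeD bounded_time_bermudan[THEN conjunct1])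
  then have "stopping_time F (tuple_max I \<sigma>)"
    using I by (simp add: stopping_time_def tuple_max_def)
  moreover have "tuple_max I \<sigma> \<in> space M \<rightarrow> {0..T}"
  proof
    fix \<omega> assume "\<omega> \<in> space M"
    then show "tuple_max I \<sigma> \<omega> \<in> {0..T}"
      using mem[of \<omega>] bounded_time_bermudan[OF \<sigma>] by (force simp: Pi_iff)
  qed
  ultimately show ?thesis by (simp add: bermudan_times_iff)
qed

lemma tuple_min_bermudan:
  assumes I: "finite I" "I \<noteq> {}" and \<sigma>: "\<And>i. i \<in> I \<Longrightarrow> \<sigma> i \<in> \<Theta>"
  shows "tuple_min I \<sigma> \<in> \<Theta>"
proof -
  have mem: "tuple_min I \<sigma> \<omega> \<in> (\<lambda>i. \<sigma> i \<omega>) ` I" for \<omega>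
    unfolding tuple_min_def using I by (intro Min_in) auto
  have "AE \<omega> in M. \<forall>i\<in>I. \<sigma> i \<omega> = T \<or> (\<exists>k. \<sigma> i \<omega> = \<theta> k \<omega>)"
    using \<sigma> I by (intro AE_finite_allI) (auto simp: bermudan_times_iff)
  then have "AE \<omega> in M. tuple_min I \<sigma> \<omega> = T \<or> (\<exists>k. tuple_min I \<sigma> \<omega> = \<theta> k \<omega>)"
    by eventually_elim (use mem in fastforce)
  moreover have "Measurable.pred (F t) (\<lambda>\<omega>. \<exists>i\<in>I. \<sigma> i \<omega> \<le> t)" for t
    using \<sigma> I by (intro pred_intros_finite stopping_timeD bounded_time_bermudan[THEN conjunct1])
  then have "stopping_time F (tuple_min I \<sigma>)"
    using I by (simp add: stopping_time_def tuple_min_def Min_le_iff)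
  moreover have "tuple_min I \<sigma> \<in> space M \<rightarrow> {0..T}"
  proof
    fix \<omega> assume "\<omega> \<in> space M"
    then show "tuple_min I \<sigma> \<omega> \<in> {0..T}"
      using mem[of \<omega>] bounded_time_bermudan[OF \<sigma>] by (force simp: Pi_iff)
  qed
  ultimately show ?thesis by (simp add: bermudan_times_iff)
qed

lemma glue_bermudan:
  assumes R: "R \<in> \<Theta>" and B: "B \<in> sets (pre_sigma R)"
    and \<sigma>: "\<sigma> \<in> \<Theta>_from R" and \<nu>: "\<nu> \<in> \<Theta>_from R"
  shows "(\<lambda>\<omega>. if \<omega> \<in> B then \<sigma> \<omega> else \<nu> \<omega>) \<in> \<Theta>_from R"
proof -
  let ?g = "\<lambda>\<omega>. if \<omega> \<in> B then \<sigma> \<omega> else \<nu> \<omega>"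
  have b: "bounded_time R" "bounded_time \<sigma>" "bounded_time \<nu>"
    and le: "AE \<omega> in M. R \<omega> \<le> \<sigma> \<omega>" "AE \<omega> in M. R \<omega> \<le> \<nu> \<omega>"
    and \<theta>: "AE \<omega> in M. \<sigma> \<omega> = T \<or> (\<exists>k. \<sigma> \<omega> = \<theta> k \<omega>)" "AE \<omega> in M. \<nu> \<omega> = T \<or> (\<exists>k. \<nu> \<omega> = \<theta> k \<omega>)"
    using R \<sigma> \<nu> by (auto simp: times_from_def bermudan_times_iff)
  have C: "space M - B \<in> sets (pre_sigma R)"
    using sets.compl_sets[OF B] by (simp add: space_pre_sigma)
  have "stopping_time F ?g"
  proof
    fix t
    have "{\<omega> \<in> B. \<sigma> \<omega> \<le> t} \<in> sets (F t)"
      using pre_sigma_mono_AE[OF b(1,2) le(1)] b B by (intro sets_pre_sigmaD) auto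
    moreover have "{\<omega> \<in> space M - B. \<nu> \<omega> \<le> t} \<in> sets (F t)"
      using pre_sigma_mono_AE[OF b(1,3) le(2)] b C by (intro sets_pre_sigmaD) auto
    ultimately have "{\<omega> \<in> B. \<sigma> \<omega> \<le> t} \<union> {\<omega> \<in> space M - B. \<nu> \<omega> \<le> t} \<in> sets (F t)" by auto
    also have "{\<omega> \<in> B. \<sigma> \<omega> \<le> t} \<union> {\<omega> \<in> space M - B. \<nu> \<omega> \<le> t} = {\<omega> \<in> space M. ?g \<omega> \<le> t}"
      using sets.sets_into_space[OF B] by (auto simp: space_pre_sigma)
    finally show "Measurable.pred (F t) (\<lambda>\<omega>. ?g \<omega> \<le> t)" by (simp add: pred_def space_F)
  qed
  moreover have "?g \<in> space M \<rightarrow> {0..T}" using b by (auto simp: Pi_iff)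
  moreover have "AE \<omega> in M. ?g \<omega> = T \<or> (\<exists>k. ?g \<omega> = \<theta> k \<omega>)"
    using \<theta> by eventually_elim auto
  moreover have "AE \<omega> in M. R \<omega> \<le> ?g \<omega>" using le by eventually_elim auto
  ultimately show ?thesis by (simp add: times_from_def bermudan_times_iff)
qed

end


section \<open>Tuples of times with a given minimum\<close>

locale multiple_stopping = nonlinear_operators M F T \<theta> p \<rho>
  for M :: "'a measure" and F :: "real \<Rightarrow> 'a measure" and T :: real
    and \<theta> :: "nat \<Rightarrow> 'a \<Rightarrow> real" and p :: ennreal
    and \<rho> :: "('a \<Rightarrow> real) \<Rightarrow> ('a \<Rightarrow> real) \<Rightarrow> ('a \<Rightarrow> real) \<Rightarrow> 'a \<Rightarrow> real" +
  fixes d :: nat and \<psi> :: "(nat \<Rightarrow> 'a \<Rightarrow> real) \<Rightarrow> 'a \<Rightarrow> real"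
  assumes d_pos: "1 \<le> d"
    and d_prop: "d_property M F \<Theta> p \<rho> d"
    and \<psi>_admissible: "d_admissible M F \<Theta> d \<psi>"
    and \<psi>_integrable: "d_p_integrable M \<Theta> p d \<psi>"
    and V_integrable: "\<And>R. R \<in> \<Theta> \<Longrightarrow>
      \<exists>f\<in>Lp M M p. AE \<omega> in M. value_V M \<Theta> \<rho> d \<psi> R \<omega> = ereal (f \<omega>)"
begin

abbreviation gain :: "('a \<Rightarrow> real) \<Rightarrow> (nat \<Rightarrow> 'a \<Rightarrow> real) \<Rightarrow> 'a \<Rightarrow> real" where
  "gain R \<sigma> \<equiv> \<rho> R (tuple_max {1..d} \<sigma>) (\<psi> \<sigma>)"

abbreviation V :: "('a \<Rightarrow> real) \<Rightarrow> 'a \<Rightarrow> ereal" where "V \<equiv> value_V M \<Theta> \<rho> d \<psi>"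

abbreviation u\<^sub>i :: "nat \<Rightarrow> ('a \<Rightarrow> real) \<Rightarrow> 'a \<Rightarrow> ereal" where "u\<^sub>i \<equiv> value_ui M \<Theta> \<rho> d \<psi>"

abbreviation \<phi> :: "('a \<Rightarrow> real) \<Rightarrow> 'a \<Rightarrow> ereal" where "\<phi> \<equiv> reward_phi M \<Theta> \<rho> d \<psi>"

abbreviation \<phi>\<^sub>r :: "('a \<Rightarrow> real) \<Rightarrow> 'a \<Rightarrow> real" where "\<phi>\<^sub>r R \<equiv> (\<lambda>\<omega>. real_of_ereal (\<phi> R \<omega>))"

text \<open>The minimum equals \<open>R\<close> only almost surely, so that the tuples which \<open>u\<^sub>i\<close> ranges over,
  with \<open>R\<close> inserted at \<open>i\<close>, belong to the set: their other entries are only almost surely above \<open>R\<close>.\<close>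

definition tuples_at :: "('a \<Rightarrow> real) \<Rightarrow> (nat \<Rightarrow> 'a \<Rightarrow> real) set" where
  "tuples_at R = {\<sigma> \<in> {1..d} \<rightarrow>\<^sub>E \<Theta>. AE \<omega> in M. tuple_min {1..d} \<sigma> \<omega> = R \<omega>}"

lemma tuple_max_mem: "\<sigma> \<in> {1..d} \<rightarrow>\<^sub>E \<Theta> \<Longrightarrow> tuple_max {1..d} \<sigma> \<in> \<Theta>"
  using d_pos by (intro tuple_max_bermudan) auto

lemma tuple_min_mem: "\<sigma> \<in> {1..d} \<rightarrow>\<^sub>E \<Theta> \<Longrightarrow> tuple_min {1..d} \<sigma> \<in> \<Theta>"
  using d_pos by (intro tuple_min_bermudan) auto

lemma \<psi>_Lp:
  assumes \<sigma>: "\<sigma> \<in> {1..d} \<rightarrow>\<^sub>E \<Theta>"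
  shows "\<psi> \<sigma> \<in> Lp M (pre_sigma (tuple_max {1..d} \<sigma>)) p"
proof -
  have "\<psi> \<sigma> \<in> Lp M M p" "\<psi> \<sigma> \<in> borel_measurable (pre_sigma (tuple_max {1..d} \<sigma>))"
    using \<psi>_integrable \<psi>_admissible \<sigma> by (auto simp: d_p_integrable_def d_admissible_def)
  then show ?thesis unfolding Lp_def by blast
qed

lemma gain_Lp: "R \<in> \<Theta> \<Longrightarrow> \<sigma> \<in> {1..d} \<rightarrow>\<^sub>E \<Theta> \<Longrightarrow> gain R \<sigma> \<in> Lp M (pre_sigma R) p"
  by (intro maps_Lp tuple_max_mem \<psi>_Lp)

lemma gain_measurable:
  assumes "R \<in> \<Theta>" "\<sigma> \<in> {1..d} \<rightarrow>\<^sub>E \<Theta>"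
  shows "gain R \<sigma> \<in> borel_measurable (pre_sigma R)" "gain R \<sigma> \<in> borel_measurable M"
  using gain_Lp[OF assms] Lp_pre_sigma_imp_Lp[OF bounded_time_bermudan[OF assms(1)] gain_Lp[OF assms]]
  by (auto simp: Lp_def)

lemma tuples_atD: "\<sigma> \<in> tuples_at R \<Longrightarrow> \<sigma> \<in> {1..d} \<rightarrow>\<^sub>E \<Theta>"
  by (simp add: tuples_at_def)

lemma tuples_at_from:
  assumes \<sigma>: "\<sigma> \<in> tuples_at R"
  shows "\<sigma> \<in> {1..d} \<rightarrow>\<^sub>E \<Theta>_from R"
proof -
  have "AE \<omega> in M. R \<omega> \<le> \<sigma> i \<omega>" if "i \<in> {1..d}" for i
  proof -
    have "AE \<omega> in M. tuple_min {1..d} \<sigma> \<omega> = R \<omega>" using \<sigma> by (simp add: tuples_at_def)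
    then show ?thesis by eventually_elim (metis tuple_min_le[OF finite_atLeastAtMost that])
  qed
  then show ?thesis using \<sigma> by (auto simp: tuples_at_def PiE_iff times_from_def)
qed

lemma tuple_max_from:
  assumes \<sigma>: "\<sigma> \<in> {1..d} \<rightarrow>\<^sub>E \<Theta>_from R"
  shows "tuple_max {1..d} \<sigma> \<in> \<Theta>_from R"
proof -
  have 1: "1 \<in> {1..d}" using d_pos by simp
  have "AE \<omega> in M. R \<omega> \<le> \<sigma> 1 \<omega>" using \<sigma> 1 by (auto simp: PiE_iff times_from_def)
  then have "AE \<omega> in M. R \<omega> \<le> tuple_max {1..d} \<sigma> \<omega>"
  proof eventually_elim
    case (elim \<omega>)
    then show ?case using le_tuple_max[OF finite_atLeastAtMost 1, of \<sigma> \<omega>] by linarith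
  qed
  then show ?thesis using tuple_max_mem[OF tuples_fromD[OF \<sigma>]] by (simp add: times_from_def)
qed

lemma insert_time_in_tuples_at:
  assumes R: "R \<in> \<Theta>" and i: "i \<in> {1..d}" and \<nu>: "\<nu> \<in> ({1..d} - {i}) \<rightarrow>\<^sub>E \<Theta>_from R"
  shows "\<nu>(i := R) \<in> tuples_at R"
proof -
  have "AE \<omega> in M. \<forall>j\<in>{1..d} - {i}. R \<omega> \<le> \<nu> j \<omega>"
    using \<nu> by (intro AE_finite_allI) (auto simp: PiE_iff times_from_def)
  then have "AE \<omega> in M. tuple_min {1..d} (\<nu>(i := R)) \<omega> = R \<omega>"
  proof eventually_elim
    case (elim \<omega>)
    show ?case unfolding tuple_min_def
    proof (rule Min_eqI)
      show "R \<omega> \<le> y" if "y \<in> (\<lambda>j. (\<nu>(i := R)) j \<omega>) ` {1..d}" for y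
        using that elim by (auto split: if_splits)
      show "R \<omega> \<in> (\<lambda>j. (\<nu>(i := R)) j \<omega>) ` {1..d}"
        using i by (intro image_eqI[of _ _ i]) simp_all
    qed simp
  qed
  moreover have "\<nu>(i := R) \<in> {1..d} \<rightarrow>\<^sub>E \<Theta>"
    using R i \<nu> by (auto simp: PiE_iff extensional_def times_from_def)
  ultimately show ?thesis by (simp add: tuples_at_def)
qed

lemma drop_time_then_insert:
  assumes R: "R \<in> \<Theta>" and i: "i \<in> {1..d}" and \<sigma>: "\<sigma> \<in> tuples_at R"
  shows "restrict \<sigma> ({1..d} - {i}) \<in> ({1..d} - {i}) \<rightarrow>\<^sub>E \<Theta>_from R"
    and "(restrict \<sigma> ({1..d} - {i}))(i := R) = \<sigma>(i := R)"
proof -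
  show "restrict \<sigma> ({1..d} - {i}) \<in> ({1..d} - {i}) \<rightarrow>\<^sub>E \<Theta>_from R"
    using tuples_at_from[OF \<sigma>] by (simp add: PiE_iff)
  have "\<sigma> \<in> extensional {1..d}" using tuples_atD[OF \<sigma>] by (simp add: PiE_iff)
  then show "(restrict \<sigma> ({1..d} - {i}))(i := R) = \<sigma>(i := R)"
    by (auto simp: fun_eq_iff extensional_def)
qed

text \<open>This is the d-property, with the minimum of either tuple exchanged for \<open>R\<close> by the
  admissibility of \<open>\<rho>\<close> in its first argument.\<close>

lemma gain_local:
  assumes R: "R \<in> \<Theta>" and \<sigma>: "\<sigma> \<in> tuples_at R" and \<sigma>': "\<sigma>' \<in> tuples_at R"
    and B: "B \<in> sets (pre_sigma R)"
    and eq: "\<And>i. i \<in> {1..d} \<Longrightarrow> AE \<omega> in M. \<omega> \<in> B \<longrightarrow> \<sigma> i \<omega> = \<sigma>' i \<omega>"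
  shows "AE \<omega> in M. \<omega> \<in> B \<longrightarrow> gain R \<sigma> \<omega> = gain R \<sigma>' \<omega>"
proof -
  let ?m = "tuple_min {1..d}"
  have min: "AE \<omega> in M. R \<omega> = ?m \<sigma> \<omega>" "AE \<omega> in M. R \<omega> = ?m \<sigma>' \<omega>"
    using \<sigma> \<sigma>' by (simp_all add: tuples_at_def eq_commute[of "R _"])
  have "AE \<omega> in M. R \<omega> = ?m \<sigma> \<omega> \<longrightarrow> gain R \<sigma> \<omega> = gain (?m \<sigma>) \<sigma> \<omega>"
    "AE \<omega> in M. R \<omega> = ?m \<sigma>' \<omega> \<longrightarrow> gain R \<sigma>' \<omega> = gain (?m \<sigma>') \<sigma>' \<omega>"
    by (intro admissibility R tuple_min_mem tuple_max_mem \<psi>_Lp tuples_atD[OF \<sigma>] tuples_atD[OF \<sigma>'])+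
  moreover have "B \<in> sets (pre_sigma (?m \<sigma>))"
  proof -
    have "sets (pre_sigma R) \<subseteq> sets (pre_sigma (?m \<sigma>))"
      using min(1) by (intro pre_sigma_mono_AE bounded_time_bermudan R tuple_min_mem tuples_atD[OF \<sigma>]) auto
    then show ?thesis using B by blast
  qed
  then have "AE \<omega> in M. \<omega> \<in> B \<longrightarrow> gain (?m \<sigma>) \<sigma> \<omega> = gain (?m \<sigma>') \<sigma>' \<omega>"
    using d_prop[unfolded d_property_def, rule_format, OF conjI[OF \<psi>_admissible \<psi>_integrable]
        tuples_atD[OF \<sigma>] tuples_atD[OF \<sigma>']] eq by blast
  ultimately show ?thesis using min by eventually_elim auto
qed

text \<open>Follow \<open>\<sigma>\<close> where its gain is the larger one and \<open>\<nu>\<close> elsewhere. The choice is known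
  at \<open>R\<close>, hence no later than any time of either tuple, and so the glued entries are stopping times.\<close>

lemma gain_directed:
  assumes R: "R \<in> \<Theta>" and \<sigma>: "\<sigma> \<in> tuples_at R" and \<nu>: "\<nu> \<in> tuples_at R"
  shows "\<exists>\<kappa>\<in>tuples_at R. AE \<omega> in M. gain R \<sigma> \<omega> \<le> gain R \<kappa> \<omega> \<and> gain R \<nu> \<omega> \<le> gain R \<kappa> \<omega>"
proof -
  note [measurable] = gain_measurable(1)[OF R tuples_atD[OF \<sigma>]] gain_measurable(1)[OF R tuples_atD[OF \<nu>]]
  define B where "B = {\<omega> \<in> space (pre_sigma R). gain R \<nu> \<omega> \<le> gain R \<sigma> \<omega>}"
  have B: "B \<in> sets (pre_sigma R)" unfolding B_def by measurable
  have C: "space (pre_sigma R) - B \<in> sets (pre_sigma R)" using B by (rule sets.compl_sets)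
  define \<kappa> where "\<kappa> = (\<lambda>i\<in>{1..d}. \<lambda>\<omega>. if \<omega> \<in> B then \<sigma> i \<omega> else \<nu> i \<omega>)"
  have "\<kappa> i \<in> \<Theta>" if "i \<in> {1..d}" for i
  proof -
    have "\<sigma> i \<in> \<Theta>_from R" "\<nu> i \<in> \<Theta>_from R"
      using that tuples_at_from[OF \<sigma>] tuples_at_from[OF \<nu>] by (auto simp: PiE_iff)
    from glue_bermudan[OF R B this] show ?thesis
      unfolding \<kappa>_def using that by (simp add: times_fromD)
  qed
  then have "\<kappa> \<in> {1..d} \<rightarrow>\<^sub>E \<Theta>" by (simp add: PiE_iff \<kappa>_def)
  moreover have "AE \<omega> in M. tuple_min {1..d} \<sigma> \<omega> = R \<omega>" "AE \<omega> in M. tuple_min {1..d} \<nu> \<omega> = R \<omega>"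
    using \<sigma> \<nu> by (simp_all add: tuples_at_def)
  then have "AE \<omega> in M. tuple_min {1..d} \<kappa> \<omega> = R \<omega>"
  proof eventually_elim
    case (elim \<omega>)
    have "(\<lambda>i. \<kappa> i \<omega>) ` {1..d} = (if \<omega> \<in> B then (\<lambda>i. \<sigma> i \<omega>) ` {1..d} else (\<lambda>i. \<nu> i \<omega>) ` {1..d})"
      by (simp add: \<kappa>_def)
    then have "tuple_min {1..d} \<kappa> \<omega> = (if \<omega> \<in> B then tuple_min {1..d} \<sigma> \<omega> else tuple_min {1..d} \<nu> \<omega>)"
      by (cases "\<omega> \<in> B") (simp_all add: tuple_min_def)
    then show ?case using elim by simp
  qed
  ultimately have \<kappa>: "\<kappa> \<in> tuples_at R" by (simp add: tuples_at_def)
  have "AE \<omega> in M. \<omega> \<in> B \<longrightarrow> gain R \<kappa> \<omega> = gain R \<sigma> \<omega>"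
    by (rule gain_local[OF R \<kappa> \<sigma> B]) (simp add: \<kappa>_def)
  moreover have "AE \<omega> in M. \<omega> \<in> space (pre_sigma R) - B \<longrightarrow> gain R \<kappa> \<omega> = gain R \<nu> \<omega>"
    by (rule gain_local[OF R \<kappa> \<nu> C]) (simp add: \<kappa>_def)
  ultimately have "AE \<omega> in M. gain R \<sigma> \<omega> \<le> gain R \<kappa> \<omega> \<and> gain R \<nu> \<omega> \<le> gain R \<kappa> \<omega>"
    using AE_space by eventually_elim (auto simp: B_def space_pre_sigma)
  with \<kappa> show ?thesis by blast
qed

section \<open>The value families as essential suprema of gains\<close>

lemma ess_sup_V:
  assumes "R \<in> \<Theta>"
  shows "is_ess_sup M ({1..d} \<rightarrow>\<^sub>E \<Theta>_from R) (\<lambda>\<sigma> \<omega>. ereal (gain R \<sigma> \<omega>)) (V R)"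
  unfolding value_V_def using assms
  by (intro is_ess_sup_ess_sup_family borel_measurable_ereal gain_measurable tuples_fromD)

lemma gain_le_V:
  "R \<in> \<Theta> \<Longrightarrow> \<sigma> \<in> {1..d} \<rightarrow>\<^sub>E \<Theta>_from R \<Longrightarrow> AE \<omega> in M. ereal (gain R \<sigma> \<omega>) \<le> V R \<omega>"
  by (rule is_ess_sup_upper[OF ess_sup_V])

lemma ess_sup_ui:
  assumes "R \<in> \<Theta>" "i \<in> {1..d}"
  shows "is_ess_sup M (({1..d} - {i}) \<rightarrow>\<^sub>E \<Theta>_from R) (\<lambda>\<nu> \<omega>. ereal (gain R (\<nu>(i := R)) \<omega>)) (u\<^sub>i i R)"
  unfolding value_ui_def using assms
  by (intro is_ess_sup_ess_sup_family borel_measurable_ereal gain_measurable tuples_atD[OF insert_time_in_tuples_at])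

lemma ui_le_phi: "i \<in> {1..d} \<Longrightarrow> u\<^sub>i i R \<omega> \<le> \<phi> R \<omega>"
  unfolding reward_phi_def by (rule Max_ge) auto

lemma gain_replace_time_le_ui:
  assumes R: "R \<in> \<Theta>" and i: "i \<in> {1..d}" and \<sigma>: "\<sigma> \<in> tuples_at R"
  shows "AE \<omega> in M. ereal (gain R (\<sigma>(i := R)) \<omega>) \<le> u\<^sub>i i R \<omega>"
  using is_ess_sup_upper[OF ess_sup_ui[OF R i] drop_time_then_insert(1)[OF R i \<sigma>]]
  unfolding drop_time_then_insert(2)[OF R i \<sigma>] .

lemma gain_replace_time:
  assumes R: "R \<in> \<Theta>" and i: "i \<in> {1..d}" and \<sigma>: "\<sigma> \<in> tuples_at R"
    and B: "B \<in> sets (pre_sigma R)" and eq: "AE \<omega> in M. \<omega> \<in> B \<longrightarrow> \<sigma> i \<omega> = R \<omega>"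
  shows "AE \<omega> in M. \<omega> \<in> B \<longrightarrow> gain R \<sigma> \<omega> = gain R (\<sigma>(i := R)) \<omega>"
proof (rule gain_local[OF R \<sigma> _ B])
  show "\<sigma>(i := R) \<in> tuples_at R"
    using insert_time_in_tuples_at[OF R i drop_time_then_insert(1)[OF R i \<sigma>]]
    unfolding drop_time_then_insert(2)[OF R i \<sigma>] .
  show "AE \<omega> in M. \<omega> \<in> B \<longrightarrow> \<sigma> j \<omega> = (\<sigma>(i := R)) j \<omega>" for j
    using eq by (cases "j = i") auto
qed

text \<open>The maximum over \<open>i\<close> of the values \<open>u\<^sub>i\<close> is the best gain among all tuples with minimum
  \<open>R\<close>: those in \<open>u\<^sub>i\<close> have the fixed entry \<open>i\<close> equal to \<open>R\<close> throughout, whereas a general tuple has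
  some entry equal to \<open>R\<close>, with an index that varies over finitely many events known at \<open>R\<close>.\<close>

lemma ess_sup_phi:
  assumes R: "R \<in> \<Theta>"
  shows "is_ess_sup M (tuples_at R) (\<lambda>\<sigma> \<omega>. ereal (gain R \<sigma> \<omega>)) (\<phi> R)"
  unfolding is_ess_sup_def
proof (intro conjI ballI impI)
  have [measurable]: "u\<^sub>i i R \<in> borel_measurable M" if "i \<in> {1..d}" for i
    using ess_sup_ui[OF R that] by (simp add: is_ess_sup_def)
  show "\<phi> R \<in> borel_measurable M"
    unfolding reward_phi_def using d_pos by measurable
next
  fix \<sigma> assume \<sigma>: "\<sigma> \<in> tuples_at R"
  have s: "stopping_time F R" "stopping_time F (\<sigma> i)" if "i \<in> {1..d}" for i
    using R tuples_atD[OF \<sigma>] that by (auto simp: PiE_iff bermudan_times_iff)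
  have "AE \<omega> in M. \<sigma> i \<omega> = R \<omega> \<longrightarrow> ereal (gain R \<sigma> \<omega>) \<le> \<phi> R \<omega>" if i: "i \<in> {1..d}" for i
  proof -
    let ?B = "{\<omega> \<in> space M. R \<omega> = \<sigma> i \<omega>}"
    have "AE \<omega> in M. \<omega> \<in> ?B \<longrightarrow> gain R \<sigma> \<omega> = gain R (\<sigma>(i := R)) \<omega>"
      by (rule gain_replace_time[OF R i \<sigma>]) (auto intro: stopping_time_eq_pre_sigma s i)
    with gain_replace_time_le_ui[OF R i \<sigma>] AE_space show ?thesis
    proof eventually_elim
      case (elim \<omega>)
      then show ?case using ui_le_phi[OF i, of R \<omega>] by auto
    qed
  qed
  then have "AE \<omega> in M. \<forall>i\<in>{1..d}. \<sigma> i \<omega> = R \<omega> \<longrightarrow> ereal (gain R \<sigma> \<omega>) \<le> \<phi> R \<omega>"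
    by (intro AE_finite_allI) auto
  moreover have "AE \<omega> in M. tuple_min {1..d} \<sigma> \<omega> = R \<omega>" using \<sigma> by (simp add: tuples_at_def)
  ultimately show "AE \<omega> in M. ereal (gain R \<sigma> \<omega>) \<le> \<phi> R \<omega>"
  proof eventually_elim
    case (elim \<omega>)
    have "tuple_min {1..d} \<sigma> \<omega> \<in> (\<lambda>i. \<sigma> i \<omega>) ` {1..d}"
      unfolding tuple_min_def using d_pos by (intro Min_in) auto
    then show ?case using elim by auto
  qed
next
  fix Y :: "'a \<Rightarrow> ereal" assume Y: "Y \<in> borel_measurable M"
    and up: "\<forall>\<sigma>\<in>tuples_at R. AE \<omega> in M. ereal (gain R \<sigma> \<omega>) \<le> Y \<omega>"
  have "AE \<omega> in M. u\<^sub>i i R \<omega> \<le> Y \<omega>" if i: "i \<in> {1..d}" for i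
    by (rule is_ess_sup_least[OF ess_sup_ui[OF R i] Y]) (intro up[rule_format] insert_time_in_tuples_at R i)
  then have "AE \<omega> in M. \<forall>i\<in>{1..d}. u\<^sub>i i R \<omega> \<le> Y \<omega>"
    by (intro AE_finite_allI) auto
  then show "AE \<omega> in M. \<phi> R \<omega> \<le> Y \<omega>"
  proof eventually_elim
    case (elim \<omega>)
    then show ?case unfolding reward_phi_def using d_pos by (subst Max_le_iff) auto
  qed
qed

lemma tuples_at_nonempty: "R \<in> \<Theta> \<Longrightarrow> tuples_at R \<noteq> {}"
proof -
  assume R: "R \<in> \<Theta>"
  have "(\<lambda>i\<in>{1..d}. R) \<in> {1..d} \<rightarrow>\<^sub>E \<Theta>" using R by auto
  moreover have "tuple_min {1..d} (\<lambda>i\<in>{1..d}. R) \<omega> = R \<omega>" for \<omega>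
    using d_pos by (simp add: tuple_min_def cong: image_cong_simp)
  ultimately have "(\<lambda>i\<in>{1..d}. R) \<in> tuples_at R" by (simp only: tuples_at_def mem_Collect_eq) simp
  then show ?thesis by blast
qed

text \<open>The increasing sequence of gains makes the Fatou property applicable to \<open>\<phi>\<close>, and also
  shows that \<open>\<phi> R\<close> is known at \<open>R\<close>: as an essential supremum it is a priori measurable only with
  respect to \<open>M\<close>, but it agrees almost surely with a countable supremum of gains. Integrability
  comes from the bounds \<open>gain R (s 0) \<le> \<phi> R \<le> V R\<close>.\<close>

lemma phi_limit_of_gains:
  assumes R: "R \<in> \<Theta>"
  shows "\<phi>\<^sub>r R \<in> Lp M (pre_sigma R) p" "AE \<omega> in M. \<phi> R \<omega> = ereal (\<phi>\<^sub>r R \<omega>)"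
    and "\<exists>s. (\<forall>n. s n \<in> tuples_at R) \<and> (\<forall>n. AE \<omega> in M. gain R (s n) \<omega> \<le> gain R (s (Suc n)) \<omega>) \<and>
      (AE \<omega> in M. (\<lambda>n. gain R (s n) \<omega>) \<longlonglongrightarrow> \<phi>\<^sub>r R \<omega>)"
proof -
  have bR: "bounded_time R" using R by (rule bounded_time_bermudan)
  have "\<exists>s. (\<forall>n. s n \<in> tuples_at R) \<and>
      (\<forall>n. AE \<omega> in M. gain R (s n) \<omega> \<le> gain R (s (Suc n)) \<omega>) \<and>
      (\<forall>\<sigma>\<in>tuples_at R. AE \<omega> in M. ereal (gain R \<sigma> \<omega>) \<le> (SUP n. ereal (gain R (s n) \<omega>)))"
    by (rule directed_family_countable_sup[OF tuples_at_nonempty[OF R] gain_measurable(2)[OF R tuples_atD]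
        gain_directed[OF R]])
  then obtain s where s: "\<And>n. s n \<in> tuples_at R"
    "\<And>n. AE \<omega> in M. gain R (s n) \<omega> \<le> gain R (s (Suc n)) \<omega>"
    "\<And>\<sigma>. \<sigma> \<in> tuples_at R \<Longrightarrow> AE \<omega> in M. ereal (gain R \<sigma> \<omega>) \<le> (SUP n. ereal (gain R (s n) \<omega>))"
    by blast
  define Z where "Z \<omega> = (SUP n. ereal (gain R (s n) \<omega>))" for \<omega>
  note [measurable] = gain_measurable[OF R tuples_atD[OF s(1)]]
  have ZM[measurable]: "Z \<in> borel_measurable M" "Z \<in> borel_measurable (pre_sigma R)"
    unfolding Z_def by measurable
  have "AE \<omega> in M. \<forall>n. ereal (gain R (s n) \<omega>) \<le> \<phi> R \<omega>"
    unfolding AE_all_countable by (intro allI is_ess_sup_upper[OF ess_sup_phi[OF R]] s(1))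
  moreover have "AE \<omega> in M. \<phi> R \<omega> \<le> Z \<omega>"
    by (rule is_ess_sup_least[OF ess_sup_phi[OF R] ZM(1)]) (simp only: Z_def s(3))
  ultimately have phi_Z: "AE \<omega> in M. \<phi> R \<omega> = Z \<omega>"
    by eventually_elim (simp add: Z_def SUP_le_iff antisym)
  obtain f where f: "f \<in> Lp M M p" "AE \<omega> in M. V R \<omega> = ereal (f \<omega>)"
    using V_integrable[OF R] by blast
  have "AE \<omega> in M. \<forall>n. ereal (gain R (s n) \<omega>) \<le> V R \<omega>"
    unfolding AE_all_countable by (intro allI gain_le_V[OF R] tuples_at_from s(1))
  with f(2) have bd: "AE \<omega> in M. ereal (gain R (s 0) \<omega>) \<le> Z \<omega> \<and> Z \<omega> \<le> ereal (f \<omega>)"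
    unfolding Z_def by eventually_elim (auto simp: SUP_le_iff intro: SUP_upper)
  then have fin: "AE \<omega> in M. Z \<omega> = ereal (real_of_ereal (Z \<omega>))"
  proof eventually_elim
    case (elim \<omega>)
    then show ?case by (cases "Z \<omega>") auto
  qed
  show phi: "AE \<omega> in M. \<phi> R \<omega> = ereal (\<phi>\<^sub>r R \<omega>)"
    using fin phi_Z by eventually_elim simp
  have "\<phi> R \<in> borel_measurable M" using ess_sup_phi[OF R] by (simp add: is_ess_sup_def)
  then have "\<phi>\<^sub>r R \<in> borel_measurable M" by measurable
  moreover have "(\<lambda>\<omega>. real_of_ereal (Z \<omega>)) \<in> borel_measurable (pre_sigma R)" by measurable
  then have "\<phi>\<^sub>r R \<in> borel_measurable (pre_sigma R)"
    by (rule borel_measurable_pre_sigma_AE_cong[OF bR]) (use phi_Z in \<open>eventually_elim, simp\<close>)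
  moreover have "AE \<omega> in M. gain R (s 0) \<omega> \<le> \<phi>\<^sub>r R \<omega> \<and> \<phi>\<^sub>r R \<omega> \<le> f \<omega>"
    using bd phi_Z phi
  proof eventually_elim
    case (elim \<omega>)
    have "ereal (gain R (s 0) \<omega>) \<le> ereal (\<phi>\<^sub>r R \<omega>)" "ereal (\<phi>\<^sub>r R \<omega>) \<le> ereal (f \<omega>)"
      using elim(1) unfolding trans[OF elim(3)[symmetric] elim(2)] by blast+
    then show ?case by (simp only: ereal_less_eq)
  qed
  ultimately show "\<phi>\<^sub>r R \<in> Lp M (pre_sigma R) p"
    using Lp_between[OF Lp_pre_sigma_imp_Lp(2)[OF bR gain_Lp[OF R tuples_atD[OF s(1)]]] f(1)]
    by blast
  have "AE \<omega> in M. \<forall>n. gain R (s n) \<omega> \<le> gain R (s (Suc n)) \<omega>"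
    using s(2) by (simp add: AE_all_countable)
  then have "AE \<omega> in M. (\<lambda>n. gain R (s n) \<omega>) \<longlonglongrightarrow> \<phi>\<^sub>r R \<omega>"
    using phi_Z phi
  proof eventually_elim
    case (elim \<omega>)
    have "(\<lambda>n. ereal (gain R (s n) \<omega>)) \<longlonglongrightarrow> Z \<omega>"
      unfolding Z_def by (rule LIMSEQ_SUP) (use elim in \<open>auto simp: incseq_Suc_iff\<close>)
    then have "(\<lambda>n. ereal (gain R (s n) \<omega>)) \<longlonglongrightarrow> ereal (\<phi>\<^sub>r R \<omega>)"
      unfolding trans[OF elim(3)[symmetric] elim(2)] .
    then show ?case by (simp only: lim_ereal)
  qed
  then show "\<exists>s. (\<forall>n. s n \<in> tuples_at R) \<and>
      (\<forall>n. AE \<omega> in M. gain R (s n) \<omega> \<le> gain R (s (Suc n)) \<omega>) \<and>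
      (AE \<omega> in M. (\<lambda>n. gain R (s n) \<omega>) \<longlonglongrightarrow> \<phi>\<^sub>r R \<omega>)"
    by (intro exI[of _ s] conjI allI s(1,2))
qed

section \<open>Optimality of the minimum\<close>

lemma gain_tower:
  assumes S: "S \<in> \<Theta>" and R: "R \<in> \<Theta>_from S" and \<sigma>: "\<sigma> \<in> {1..d} \<rightarrow>\<^sub>E \<Theta>_from R"
  shows "AE \<omega> in M. \<rho> S R (gain R \<sigma>) \<omega> = gain S \<sigma> \<omega>"
  by (intro consistency S R tuple_max_from \<sigma> \<psi>_Lp tuples_fromD[OF \<sigma>])

text \<open>Stopping at \<open>R\<close> with reward \<open>\<phi> R\<close> is the limit of strategies which continue with an
  almost optimal tuple from \<open>R\<close> on, and each of these competes in \<open>V S\<close>.\<close>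

lemma rho_phi_le_V:
  assumes S: "S \<in> \<Theta>" and R: "R \<in> \<Theta>_from S"
  shows "AE \<omega> in M. ereal (\<rho> S R (\<phi>\<^sub>r R) \<omega>) \<le> V S \<omega>"
proof -
  have R': "R \<in> \<Theta>" using R by (rule times_fromD)
  obtain s where s: "\<And>n. s n \<in> tuples_at R"
    "\<And>n. AE \<omega> in M. gain R (s n) \<omega> \<le> gain R (s (Suc n)) \<omega>"
    "AE \<omega> in M. (\<lambda>n. gain R (s n) \<omega>) \<longlonglongrightarrow> \<phi>\<^sub>r R \<omega>"
    using phi_limit_of_gains(3)[OF R'] by blast
  have "AE \<omega> in M. ereal (\<rho> S R (\<phi>\<^sub>r R) \<omega>) \<le> liminf (\<lambda>n. ereal (\<rho> S R (gain R (s n)) \<omega>))"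
    using s by (intro monotone_Fatou S R' gain_Lp tuples_atD phi_limit_of_gains(1))
  moreover have "AE \<omega> in M. \<forall>n. ereal (\<rho> S R (gain R (s n)) \<omega>) \<le> V S \<omega>"
    unfolding AE_all_countable
  proof
    fix n
    have from_R: "s n \<in> {1..d} \<rightarrow>\<^sub>E \<Theta>_from R" using s(1) by (rule tuples_at_from)
    have "AE \<omega> in M. S \<omega> \<le> s n i \<omega>" if "i \<in> {1..d}" for i
    proof -
      have "AE \<omega> in M. S \<omega> \<le> R \<omega>" "AE \<omega> in M. R \<omega> \<le> s n i \<omega>"
        using R from_R that by (auto simp: times_from_def PiE_iff)
      then show ?thesis by eventually_elim simp
    qed
    then have "s n \<in> {1..d} \<rightarrow>\<^sub>E \<Theta>_from S"
      using from_R by (auto simp: times_from_def PiE_iff)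
    from gain_le_V[OF S this] gain_tower[OF S R from_R]
    show "AE \<omega> in M. ereal (\<rho> S R (gain R (s n)) \<omega>) \<le> V S \<omega>" by eventually_elim simp
  qed
  ultimately show ?thesis
  proof eventually_elim
    case (elim \<omega>)
    note elim(1)
    also have "liminf (\<lambda>n. ereal (\<rho> S R (gain R (s n)) \<omega>)) \<le> V S \<omega>"
      using elim(2) by (intro Liminf_le) auto
    finally show ?case .
  qed
qed

lemma ess_sup_u:
  assumes S: "S \<in> \<Theta>"
  shows "is_ess_sup M (\<Theta>_from S) (\<lambda>R \<omega>. ereal (\<rho> S R (\<phi>\<^sub>r R) \<omega>)) (value_u M \<Theta> \<rho> d \<psi> S)"
  unfolding value_u_def
proof (rule is_ess_sup_ess_sup_family)
  fix R assume "R \<in> \<Theta>_from S"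
  then have R: "R \<in> \<Theta>" by (rule times_fromD)
  have "\<rho> S R (\<phi>\<^sub>r R) \<in> borel_measurable M"
    by (rule Lp_pre_sigma_imp_Lp(1)[OF bounded_time_bermudan[OF S] maps_Lp[OF S R phi_limit_of_gains(1)[OF R]]])
  then show "(\<lambda>\<omega>. ereal (\<rho> S R (\<phi>\<^sub>r R) \<omega>)) \<in> borel_measurable M"
    by (rule borel_measurable_ereal)
qed

text \<open>Besides the optimality of \<open>m\<close>, the equality of \<open>\<rho> S m\<close> on the two rewards
  \<open>gain m \<tau> \<le> \<phi> m\<close> is recorded: it is what strict monotonicity is applied to.\<close>

lemma minimum_optimal:
  assumes S: "S \<in> \<Theta>" and \<tau>: "\<tau> \<in> {1..d} \<rightarrow>\<^sub>E \<Theta>_from S"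
    and opt: "AE \<omega> in M. V S \<omega> = ereal (gain S \<tau> \<omega>)"
    and m: "m = tuple_min {1..d} \<tau>"
  shows "AE \<omega> in M. value_u M \<Theta> \<rho> d \<psi> S \<omega> = ereal (\<rho> S m (\<phi>\<^sub>r m) \<omega>)"
    and "AE \<omega> in M. \<rho> S m (gain m \<tau>) \<omega> = \<rho> S m (\<phi>\<^sub>r m) \<omega>"
    and "AE \<omega> in M. gain m \<tau> \<omega> \<le> \<phi>\<^sub>r m \<omega>"
    and "m \<in> \<Theta>_from S" and "\<tau> \<in> tuples_at m"
proof -
  note \<tau>\<Theta> = tuples_fromD[OF \<tau>]
  have m\<Theta>: "m \<in> \<Theta>" unfolding m using \<tau>\<Theta> by (rule tuple_min_mem)
  have "AE \<omega> in M. \<forall>i\<in>{1..d}. S \<omega> \<le> \<tau> i \<omega>"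
    using \<tau> by (intro AE_finite_allI) (auto simp: PiE_iff times_from_def)
  then have "AE \<omega> in M. S \<omega> \<le> m \<omega>"
  proof eventually_elim
    case (elim \<omega>)
    then show ?case unfolding m tuple_min_def using d_pos by (subst Min_ge_iff) auto
  qed
  with m\<Theta> show mS: "m \<in> \<Theta>_from S" by (simp add: times_from_def)
  show \<tau>m: "\<tau> \<in> tuples_at m" using \<tau>\<Theta> by (simp add: tuples_at_def m)
  have "AE \<omega> in M. ereal (gain m \<tau> \<omega>) \<le> \<phi> m \<omega>"
    by (rule is_ess_sup_upper[OF ess_sup_phi[OF m\<Theta>] \<tau>m])
  with phi_limit_of_gains(2)[OF m\<Theta>] show le: "AE \<omega> in M. gain m \<tau> \<omega> \<le> \<phi>\<^sub>r m \<omega>"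
    by eventually_elim (metis ereal_less_eq(3))
  have "AE \<omega> in M. \<rho> S m (gain m \<tau>) \<omega> \<le> \<rho> S m (\<phi>\<^sub>r m) \<omega>"
    by (intro monotonicity S m\<Theta> gain_Lp \<tau>\<Theta> phi_limit_of_gains(1) le)
  moreover have "AE \<omega> in M. \<rho> S m (gain m \<tau>) \<omega> = gain S \<tau> \<omega>"
    by (intro gain_tower S mS tuples_at_from \<tau>m)
  moreover have "AE \<omega> in M. ereal (\<rho> S m (\<phi>\<^sub>r m) \<omega>) \<le> value_u M \<Theta> \<rho> d \<psi> S \<omega>"
    by (rule is_ess_sup_upper[OF ess_sup_u[OF S] mS])
  moreover have "AE \<omega> in M. value_u M \<Theta> \<rho> d \<psi> S \<omega> \<le> V S \<omega>"
    by (rule is_ess_sup_least[OF ess_sup_u[OF S] _ rho_phi_le_V[OF S]])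
      (use ess_sup_V[OF S] in \<open>simp add: is_ess_sup_def\<close>)
  ultimately have "AE \<omega> in M. value_u M \<Theta> \<rho> d \<psi> S \<omega> = ereal (\<rho> S m (\<phi>\<^sub>r m) \<omega>) \<and>
      \<rho> S m (gain m \<tau>) \<omega> = \<rho> S m (\<phi>\<^sub>r m) \<omega>"
    using opt
  proof eventually_elim
    case (elim \<omega>)
    have "value_u M \<Theta> \<rho> d \<psi> S \<omega> \<le> ereal (\<rho> S m (gain m \<tau>) \<omega>)"
      using elim(4) unfolding elim(5) elim(2) .
    with elim(1,3) show ?case
      by (cases "value_u M \<Theta> \<rho> d \<psi> S \<omega>") auto
  qed
  then show "AE \<omega> in M. value_u M \<Theta> \<rho> d \<psi> S \<omega> = ereal (\<rho> S m (\<phi>\<^sub>r m) \<omega>)"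
    and "AE \<omega> in M. \<rho> S m (gain m \<tau>) \<omega> = \<rho> S m (\<phi>\<^sub>r m) \<omega>"
    by (rule AE_mp, simp)+
qed

lemma remaining_times_optimal:
  assumes sm: "strictly_monotone M F \<Theta> p \<rho>"
    and S: "S \<in> \<Theta>" and \<tau>: "\<tau> \<in> {1..d} \<rightarrow>\<^sub>E \<Theta>_from S"
    and opt: "AE \<omega> in M. V S \<omega> = ereal (gain S \<tau> \<omega>)"
    and m: "m = tuple_min {1..d} \<tau>" and i: "i \<in> {1..d}"
    and A: "A \<in> sets (pre_sigma m)" and eq: "AE \<omega> in M. \<omega> \<in> A \<longrightarrow> \<tau> i \<omega> = m \<omega>"
  shows "AE \<omega> in M. \<omega> \<in> A \<longrightarrow> u\<^sub>i i m \<omega> = ereal (gain m (\<tau>(i := m)) \<omega>)"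
proof -
  note chain = minimum_optimal[OF S \<tau> opt m]
  note m\<Theta> = times_fromD[OF chain(4)]
  have "AE \<omega> in M. gain m \<tau> \<omega> = \<phi>\<^sub>r m \<omega>"
    using sm[unfolded strictly_monotone_def, rule_format, OF S chain(4)
        gain_Lp[OF m\<Theta> tuples_fromD[OF \<tau>]] phi_limit_of_gains(1)[OF m\<Theta>] chain(3,2)] .
  with phi_limit_of_gains(2)[OF m\<Theta>] gain_replace_time[OF m\<Theta> i chain(5) A eq]
    gain_replace_time_le_ui[OF m\<Theta> i chain(5)]
  show ?thesis
  proof eventually_elim
    case (elim \<omega>)
    show ?case
    proof
      assume "\<omega> \<in> A"
      then have eq: "\<phi> m \<omega> = ereal (gain m (\<tau>(i := m)) \<omega>)"
        using elim by simp
      show "u\<^sub>i i m \<omega> = ereal (gain m (\<tau>(i := m)) \<omega>)"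
        using ui_le_phi[OF i, of m \<omega>] elim(3) unfolding eq by (rule antisym)
    qed
  qed
qed

end

theorem proposition7:
  fixes M :: "'a measure" and F :: "real \<Rightarrow> 'a measure" and T :: real
    and \<theta> :: "nat \<Rightarrow> 'a \<Rightarrow> real" and p :: ennreal
    and \<rho> :: "('a \<Rightarrow> real) \<Rightarrow> ('a \<Rightarrow> real) \<Rightarrow> ('a \<Rightarrow> real) \<Rightarrow> 'a \<Rightarrow> real"
    and \<Theta> :: "('a \<Rightarrow> real) set" and d :: nat
    and \<psi> :: "(nat \<Rightarrow> 'a \<Rightarrow> real) \<Rightarrow> 'a \<Rightarrow> real"
    and S m :: "'a \<Rightarrow> real" and \<tau> :: "nat \<Rightarrow> 'a \<Rightarrow> real" and A :: "nat \<Rightarrow> 'a set"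
  assumes operators: "nonlinear_operators M F T \<theta> p \<rho>"
    and \<Theta>: "\<Theta> = bermudan_times M F T \<theta>"
    and d: "2 \<le> d"
    and d_prop: "d_property M F \<Theta> p \<rho> d"
    and \<psi>_admissible: "d_admissible M F \<Theta> d \<psi>"
    and \<psi>_integrable: "d_p_integrable M \<Theta> p d \<psi>"
    and V_integrable: "\<And>R. R \<in> \<Theta> \<Longrightarrow>
      \<exists>f\<in>Lp M M p. AE \<omega> in M. value_V M \<Theta> \<rho> d \<psi> R \<omega> = ereal (f \<omega>)"
    and S: "S \<in> \<Theta>"
    and \<tau>: "\<tau> \<in> {1..d} \<rightarrow>\<^sub>E times_from M \<Theta> S"
    and \<tau>_optimal: "AE \<omega> in M.
      value_V M \<Theta> \<rho> d \<psi> S \<omega> = ereal (\<rho> S (tuple_max {1..d} \<tau>) (\<psi> \<tau>) \<omega>)"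
    and m: "m = tuple_min {1..d} \<tau>"
    and A_sets: "\<And>i. i \<in> {1..d} \<Longrightarrow> A i \<in> sets (sigma_at M F m)"
    and A_partition: "AE \<omega> in M. \<exists>!i. i \<in> {1..d} \<and> \<omega> \<in> A i"
    and A_min: "\<And>i. i \<in> {1..d} \<Longrightarrow> AE \<omega> in M. \<omega> \<in> A i \<longrightarrow> \<tau> i \<omega> = m \<omega>"
  shows "(AE \<omega> in M. value_u M \<Theta> \<rho> d \<psi> S \<omega> =
        ereal (\<rho> S m (\<lambda>\<omega>'. real_of_ereal (reward_phi M \<Theta> \<rho> d \<psi> m \<omega>')) \<omega>)) \<and>
    (strictly_monotone M F \<Theta> p \<rho> \<longrightarrow>
      (\<forall>i\<in>{1..d}. AE \<omega> in M. \<omega> \<in> A i \<longrightarrow>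
        value_ui M \<Theta> \<rho> d \<psi> i m \<omega> =
          ereal (\<rho> m (tuple_max {1..d} (\<tau>(i := m))) (\<psi> (\<tau>(i := m))) \<omega>)))"
proof -
  interpret nonlinear_operators M F T \<theta> p \<rho> by (rule operators)
  interpret multiple_stopping M F T \<theta> p \<rho> d \<psi>
    using d d_prop \<psi>_admissible \<psi>_integrable V_integrable by unfold_locales (simp_all add: \<Theta>)
  show ?thesis
    unfolding \<Theta>
  proof (intro conjI impI ballI)
    show "AE \<omega> in M. value_u M (bermudan_times M F T \<theta>) \<rho> d \<psi> S \<omega> =
        ereal (\<rho> S m (\<lambda>\<omega>'. real_of_ereal (reward_phi M (bermudan_times M F T \<theta>) \<rho> d \<psi> m \<omega>')) \<omega>)"
      using S \<tau> \<tau>_optimal m unfolding \<Theta> by (rule minimum_optimal(1))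
  next
    fix i assume sm: "strictly_monotone M F (bermudan_times M F T \<theta>) p \<rho>" and i: "i \<in> {1..d}"
    show "AE \<omega> in M. \<omega> \<in> A i \<longrightarrow> value_ui M (bermudan_times M F T \<theta>) \<rho> d \<psi> i m \<omega> =
        ereal (\<rho> m (tuple_max {1..d} (\<tau>(i := m))) (\<psi> (\<tau>(i := m))) \<omega>)"
      using sm S \<tau> \<tau>_optimal m i A_sets[OF i] A_min[OF i] unfolding \<Theta> by (rule remaining_times_optimal)
  qed
qed

end
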